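(* Let $\mathcal{M}$ be the set of functions $f:[0,\infty)\to[0,\infty)$ of the form $$f(t)=L+Kt+\int_{(0,\infty)}(1-e^{-tx})\,d\nu(x),\qquad t\ge 0,$$ with constants $L,K\ge 0$ and $\nu$ a positive measure on $(0,\infty)$ such that $\int_{(0,\infty)}\frac{x}{1+x}\,d\nu(x)<+\infty$. To each $f\in\mathcal{M}$ associate the law of a subordinator $X=(X_\tau)_{\tau\ge 0}$ with $X_0=L$ and with Bernstein function $f-L$, i.e. such that $$\mathbb{E}\big[e^{-t(X_\tau-X_\sigma)}\big]=e^{-(\tau-\sigma)(f(t)-L)}\qquad\text{for all } t\ge 0,\ \tau\ge\sigma\ge 0 .$$ This association is well defined and is a bijection from $\mathcal{M}$ onto the set of laws of subordinators $X$ whose initial value $X_0$ is a deterministic constant in $[0,\infty)$.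
   Context: The functions in $\mathcal{M}$ are the impulse responses of non-ageing linear viscoelastic materials with one observable parameter. A subordinator is a right-continuous stochastic process $(X_\tau)_{\tau\ge 0}$ with values in $[0,\infty)$ and nondecreasing paths such that for all $0<\tau_1<\dots<\tau_n$ the variables $X_0, X_{\tau_1}-X_0,\dots,X_{\tau_n}-X_{\tau_{n-1}}$ are independent, and such that the law of $X_\tau-X_\sigma$ ($\tau\ge\sigma$) depends only on $\tau-\sigma$. The subordinators considered have infinite lifetime (no killing). Laws are laws of the whole process, i.e. processes with the same finite-dimensional distributions are identified. *)

theory Defs
  imports "HOL-Probability.Probability"
begin

section \<open>Impulse responses\<close>

text \<open>A function on the half-line \<open>[0, \<infinity>)\<close> is represented by an extensional function
  \<open>real \<Rightarrow> real\<close> (constantly \<^const>\<open>undefined\<close> off \<open>{0..}\<close>), so that equality is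
  equality on \<open>[0, \<infinity>)\<close>.\<close>

definition impulse_response_form ::
    "real \<Rightarrow> real \<Rightarrow> real measure \<Rightarrow> (real \<Rightarrow> real) \<Rightarrow> bool" where
  "impulse_response_form L K \<nu> f \<longleftrightarrow>
     0 \<le> L \<and> 0 \<le> K \<and>
     sets \<nu> = sets (restrict_space borel {0<..}) \<and>
     (\<integral>\<^sup>+x. ennreal (x / (1 + x)) \<partial>\<nu>) < \<infinity> \<and>
     (\<forall>t\<ge>0. f t = L + K * t + (LINT x|\<nu>. 1 - exp (- t * x)))"

definition impulse_responses :: "(real \<Rightarrow> real) set" where
  "impulse_responses = {f \<in> {0..} \<rightarrow>\<^sub>E {0..}. \<exists>L K \<nu>. impulse_response_form L K \<nu> f}"


section \<open>Subordinators and their laws\<close>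

text \<open>Time is \<open>{0..}\<close>; the values of \<open>X\<close> at negative times are irrelevant. The values are
  finite reals at all times, i.e. the lifetime is infinite.\<close>

locale subordinator = prob_space M for M :: "'w measure" +
  fixes X :: "real \<Rightarrow> 'w \<Rightarrow> real"
  assumes measurable_X: "\<And>\<tau>. 0 \<le> \<tau> \<Longrightarrow> X \<tau> \<in> borel_measurable M"
    and nonneg: "\<And>\<tau> \<omega>. 0 \<le> \<tau> \<Longrightarrow> \<omega> \<in> space M \<Longrightarrow> 0 \<le> X \<tau> \<omega>"
    and mono_paths: "\<And>\<omega>. \<omega> \<in> space M \<Longrightarrow> mono_on {0..} (\<lambda>\<tau>. X \<tau> \<omega>)"
    and right_continuous:
      "\<And>\<tau> \<omega>. 0 \<le> \<tau> \<Longrightarrow> \<omega> \<in> space M \<Longrightarrow> continuous (at_right \<tau>) (\<lambda>s. X s \<omega>)"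
    and independent_increments:
      "\<And>(n::nat) (\<tau> :: nat \<Rightarrow> real). \<tau> 0 = 0 \<Longrightarrow> strict_mono_on {0..n} \<tau> \<Longrightarrow>
         indep_vars (\<lambda>_. borel)
           (\<lambda>i \<omega>. if i = 0 then X 0 \<omega> else X (\<tau> i) \<omega> - X (\<tau> (i - 1)) \<omega>) {0..n}"
    and stationary_increments:
      "\<And>\<sigma> \<tau> \<sigma>' \<tau>'. 0 \<le> \<sigma> \<Longrightarrow> \<sigma> \<le> \<tau> \<Longrightarrow> 0 \<le> \<sigma>' \<Longrightarrow> \<sigma>' \<le> \<tau>' \<Longrightarrow> \<tau> - \<sigma> = \<tau>' - \<sigma>' \<Longrightarrow>
         distr M borel (\<lambda>\<omega>. X \<tau> \<omega> - X \<sigma> \<omega>) = distr M borel (\<lambda>\<omega>. X \<tau>' \<omega> - X \<sigma>' \<omega>)"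

text \<open>The law of the whole process, as a measure on the Kolmogorov product space. Two processes
  have the same law iff they have the same finite-dimensional distributions; see
  \<open>process_law_eq_iff\<close> below.\<close>

definition process_law :: "'w measure \<Rightarrow> (real \<Rightarrow> 'w \<Rightarrow> real) \<Rightarrow> (real \<Rightarrow> real) measure" where
  "process_law M X = distr M (\<Pi>\<^sub>M \<tau>\<in>{0..}. borel) (\<lambda>\<omega>. \<lambda>\<tau>\<in>{0..}. X \<tau> \<omega>)"

text \<open>A set of laws needs one fixed type of sample points. We take paths; this is no restriction:
  by \<open>deterministic_start_lawsI\<close> and \<open>associated_lawI\<close> below, processes on probability
  spaces over arbitrary types give nothing more.\<close>

definition deterministic_start_laws :: "(real \<Rightarrow> real) measure set" where
  "deterministic_start_laws =
     {process_law M X | (M :: (real \<Rightarrow> real) measure) X.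
        subordinator M X \<and> (\<exists>c\<ge>0. AE \<omega> in M. X 0 \<omega> = c)}"

definition associated_process ::
    "(real \<Rightarrow> real) \<Rightarrow> 'w measure \<Rightarrow> (real \<Rightarrow> 'w \<Rightarrow> real) \<Rightarrow> bool" where
  "associated_process f M X \<longleftrightarrow> subordinator M X \<and>
     (\<exists>L K \<nu>. impulse_response_form L K \<nu> f \<and>
        (AE \<omega> in M. X 0 \<omega> = L) \<and>
        (\<forall>t\<ge>0. \<forall>\<sigma>\<ge>0. \<forall>\<tau>\<ge>\<sigma>.
           (LINT \<omega>|M. exp (- t * (X \<tau> \<omega> - X \<sigma> \<omega>))) = exp (- (\<tau> - \<sigma>) * (f t - L))))"

definition associated_law :: "(real \<Rightarrow> real) \<Rightarrow> (real \<Rightarrow> real) measure \<Rightarrow> bool" where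
  "associated_law f P \<longleftrightarrow>
     (\<exists>(M :: (real \<Rightarrow> real) measure) X. associated_process f M X \<and> P = process_law M X)"


section \<open>Independence of the choice of sample space\<close>

lemma process_map_measurable:
  assumes "\<And>\<tau>. 0 \<le> \<tau> \<Longrightarrow> X \<tau> \<in> borel_measurable M"
  shows "(\<lambda>\<omega>. \<lambda>\<tau>\<in>{0..}. X \<tau> \<omega>) \<in> measurable M (\<Pi>\<^sub>M \<tau>\<in>{0..}. borel)"
  by (rule measurable_restrict) (use assms in auto)

lemma distr_finite_marginal:
  assumes J: "J \<subseteq> {0..}" and X: "\<And>\<tau>. 0 \<le> \<tau> \<Longrightarrow> X \<tau> \<in> borel_measurable M"
  shows "distr (process_law M X) (\<Pi>\<^sub>M \<tau>\<in>J. borel) (\<lambda>p. restrict p J) =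
    distr M (\<Pi>\<^sub>M \<tau>\<in>J. borel) (\<lambda>\<omega>. \<lambda>\<tau>\<in>J. X \<tau> \<omega>)"
proof -
  have "(\<lambda>\<omega>. \<lambda>\<tau>\<in>J. X \<tau> \<omega>) = (\<lambda>p. restrict p J) \<circ> (\<lambda>\<omega>. \<lambda>\<tau>\<in>{0..}. X \<tau> \<omega>)"
    using J by (auto simp: fun_eq_iff restrict_def)
  then show ?thesis unfolding process_law_def
    using distr_distr[OF measurable_restrict_subset[OF J] process_map_measurable[OF X]]
    by simp
qed

lemma process_law_eq_iff:
  assumes "prob_space M" "prob_space N"
    and X: "\<And>\<tau>. 0 \<le> \<tau> \<Longrightarrow> X \<tau> \<in> borel_measurable M"
    and Y: "\<And>\<tau>. 0 \<le> \<tau> \<Longrightarrow> Y \<tau> \<in> borel_measurable N"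
  shows "process_law M X = process_law N Y \<longleftrightarrow>
    (\<forall>J. finite J \<and> J \<subseteq> {0..} \<longrightarrow>
       distr M (\<Pi>\<^sub>M \<tau>\<in>J. borel) (\<lambda>\<omega>. \<lambda>\<tau>\<in>J. X \<tau> \<omega>) = distr N (\<Pi>\<^sub>M \<tau>\<in>J. borel) (\<lambda>\<omega>. \<lambda>\<tau>\<in>J. Y \<tau> \<omega>))"
    (is "?L \<longleftrightarrow> ?R")
proof
  show ?R if ?L
    by (intro allI impI) (simp add: that distr_finite_marginal[OF _ X, symmetric] distr_finite_marginal[OF _ Y, symmetric])
  show ?L if R: ?R
  proof (rule measure_eqI_PiM_infinite)
    show "sets (process_law M X) = sets (\<Pi>\<^sub>M \<tau>\<in>{0::real..}. (borel::real measure))"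
      "sets (process_law N Y) = sets (\<Pi>\<^sub>M \<tau>\<in>{0::real..}. (borel::real measure))"
      by (simp_all add: process_law_def)
    have "prob_space (process_law M X)"
      unfolding process_law_def
      by (rule prob_space.prob_space_distr[OF assms(1) process_map_measurable[OF X]])
    then show "finite_measure (process_law M X)" by (rule prob_space.finite_measure)
  next
    fix A :: "real \<Rightarrow> real set" and J :: "real set"
    assume J: "finite J" "J \<subseteq> {0..}" and A: "\<And>i. i \<in> J \<Longrightarrow> A i \<in> sets borel"
    have *: "emeasure P (prod_emb {0..} (\<lambda>_. borel) J (Pi\<^sub>E J A)) =
        emeasure (distr P (\<Pi>\<^sub>M \<tau>\<in>J. borel) (\<lambda>p. restrict p J)) (Pi\<^sub>E J A)"
      if P: "sets P = sets (\<Pi>\<^sub>M \<tau>\<in>{0..}. (borel::real measure))" for P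
    proof -
      have "(\<lambda>p. restrict p J) \<in> measurable P (\<Pi>\<^sub>M \<tau>\<in>J. (borel::real measure))"
        using measurable_restrict_subset[OF J(2)] measurable_cong_sets[OF P refl] by blast
      moreover have "Pi\<^sub>E J A \<in> sets (\<Pi>\<^sub>M \<tau>\<in>J. (borel::real measure))"
        using J A by (intro sets_PiM_I_finite) auto
      ultimately show ?thesis
        using sets_eq_imp_space_eq[OF P]
        by (simp add: emeasure_distr prod_emb_def space_PiM)
    qed
    show "emeasure (process_law M X) (prod_emb {0..} (\<lambda>_. borel) J (Pi\<^sub>E J A)) =
        emeasure (process_law N Y) (prod_emb {0..} (\<lambda>_. borel) J (Pi\<^sub>E J A))"
      using R J distr_finite_marginal[OF J(2) X] distr_finite_marginal[OF J(2) Y]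
      by (simp add: * process_law_def)
  qed
qed

lemma exists_path_space_version:
  fixes M :: "'w measure"
  assumes "subordinator M X"
  obtains N :: "(real \<Rightarrow> real) measure" and Y where
    "subordinator N Y" "process_law N Y = process_law M X"
    "\<And>c. AE \<omega> in M. X 0 \<omega> = c \<Longrightarrow> AE p in N. Y 0 p = c"
    "\<And>t \<sigma> \<tau>. 0 \<le> \<sigma> \<Longrightarrow> \<sigma> \<le> \<tau> \<Longrightarrow>
       (LINT p|N. exp (- t * (Y \<tau> p - Y \<sigma> p))) = (LINT \<omega>|M. exp (- t * (X \<tau> \<omega> - X \<sigma> \<omega>)))"
proof -
  interpret subordinator M X by fact
  define G where "G \<omega> = (\<lambda>\<tau>\<in>{0..}. X \<tau> \<omega>)" for \<omega>
  define N0 where "N0 = restrict_space (\<Pi>\<^sub>M \<tau>\<in>{0::real..}. (borel::real measure)) (G ` space M)"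
  define N where "N = distr M N0 G"
  define Y where "Y \<tau> p = p \<tau>" for \<tau> :: real and p :: "real \<Rightarrow> real"
  have G: "G \<in> measurable M N0"
    unfolding N0_def G_def
    by (rule measurable_restrict_space2) (auto intro: process_map_measurable measurable_X)
  have space_N: "space N = G ` space M"
  proof -
    have "G \<omega> \<in> {0..} \<rightarrow>\<^sub>E UNIV" for \<omega>
      unfolding G_def by (rule restrict_PiE_iff[THEN iffD2]) simp
    then show ?thesis
      by (auto simp: N_def N0_def space_restrict_space space_PiM)
  qed
  have YG: "Y \<tau> (G \<omega>) = X \<tau> \<omega>" if "0 \<le> \<tau>" for \<tau> \<omega>
    using that by (simp add: Y_def G_def)
  have Y0: "Y \<tau> \<in> borel_measurable N0" if "0 \<le> \<tau>" for \<tau>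
    unfolding Y_def N0_def
    by (rule measurable_restrict_space1, rule measurable_component_singleton) (use that in auto)
  have YN: "Y \<tau> \<in> borel_measurable N" if "0 \<le> \<tau>" for \<tau>
    using Y0[OF that] by (simp add: N_def)
  interpret N: prob_space N
    unfolding N_def by (rule prob_space_distr[OF G])
  have distr_N: "distr N L h = distr M L (\<lambda>\<omega>. h (G \<omega>))"
    if "h \<in> measurable N0 L" for h and L :: "real measure"
    unfolding N_def using distr_distr[OF that G] by (simp add: comp_def)
  have sub: "subordinator N Y"
  proof
    show "Y \<tau> \<in> borel_measurable N" if "0 \<le> \<tau>" for \<tau>
      by (rule YN[OF that])
    show "0 \<le> Y \<tau> p" if "0 \<le> \<tau>" "p \<in> space N" for \<tau> p
      using that nonneg by (auto simp: space_N YG)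
    show "mono_on {0..} (\<lambda>\<tau>. Y \<tau> p)" if "p \<in> space N" for p
      using that mono_paths by (auto simp: space_N YG mono_on_def)
    show "continuous (at_right \<tau>) (\<lambda>s. Y s p)" if "0 \<le> \<tau>" "p \<in> space N" for \<tau> p
    proof -
      from that obtain \<omega> where \<omega>: "\<omega> \<in> space M" "p = G \<omega>" by (auto simp: space_N)
      have "((\<lambda>s. X s \<omega>) \<longlongrightarrow> X \<tau> \<omega>) (at_right \<tau>)"
        using right_continuous[OF that(1) \<omega>(1)] by (simp add: continuous_within)
      moreover have "eventually (\<lambda>s. X s \<omega> = Y s p) (at_right \<tau>)"
        using that(1) by (auto simp: eventually_at_filter \<omega> YG)
      ultimately show ?thesis
        unfolding continuous_within
        using tendsto_cong[of "\<lambda>s. X s \<omega>" "\<lambda>s. Y s p"] that(1) by (simp add: \<omega> YG)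
    qed
    show "distr N borel (\<lambda>p. Y \<tau> p - Y \<sigma> p) = distr N borel (\<lambda>p. Y \<tau>' p - Y \<sigma>' p)"
      if "0 \<le> \<sigma>" "\<sigma> \<le> \<tau>" "0 \<le> \<sigma>'" "\<sigma>' \<le> \<tau>'" "\<tau> - \<sigma> = \<tau>' - \<sigma>'" for \<sigma> \<tau> \<sigma>' \<tau>'
    proof -
      have *: "distr N borel (\<lambda>p. Y b p - Y a p) = distr M borel (\<lambda>\<omega>. X b \<omega> - X a \<omega>)"
        if "0 \<le> a" "a \<le> b" for a b
      proof -
        have "0 \<le> b" using that by simp
        with that show ?thesis
          by (simp add: distr_N borel_measurable_diff Y0 YG)
      qed
      show ?thesis
        unfolding *[OF that(1,2)] *[OF that(3,4)] by (rule stationary_increments[OF that])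
    qed
    fix n :: nat and \<tau> :: "nat \<Rightarrow> real"
    assume \<tau>: "\<tau> 0 = 0" "strict_mono_on {0..n} \<tau>"
    have \<tau>_nonneg: "0 \<le> \<tau> i" if "i \<le> n" for i
      using \<tau> that strict_mono_on_leD[OF \<tau>(2), of 0 i] by simp
    let ?D = "\<lambda>Z i \<omega>. if i = 0 then Z 0 \<omega> else Z (\<tau> i) \<omega> - Z (\<tau> (i - 1)) \<omega>"
    have DY0: "?D Y i \<in> borel_measurable N0" if "i \<in> {0..n}" for i
      using that by (cases "i = 0") (auto intro!: Y0 \<tau>_nonneg borel_measurable_diff)
    have DX: "?D X i \<in> borel_measurable M" if "i \<in> {0..n}" for i
      using that by (cases "i = 0") (auto intro!: measurable_X \<tau>_nonneg borel_measurable_diff)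
    have DG: "?D Y i (G \<omega>) = ?D X i \<omega>" if "i \<in> {0..n}" for i \<omega>
      using that by (auto simp: YG \<tau>_nonneg)
    have "distr N (\<Pi>\<^sub>M i\<in>{0..n}. borel) (\<lambda>p. \<lambda>i\<in>{0..n}. ?D Y i p) =
        distr M (\<Pi>\<^sub>M i\<in>{0..n}. borel) (\<lambda>\<omega>. \<lambda>i\<in>{0..n}. ?D Y i (G \<omega>))"
      unfolding N_def
      by (subst distr_distr[OF measurable_restrict[OF DY0] G]) (auto simp: comp_def)
    also have "(\<lambda>\<omega>. \<lambda>i\<in>{0..n}. ?D Y i (G \<omega>)) = (\<lambda>\<omega>. \<lambda>i\<in>{0..n}. ?D X i \<omega>)"
      by (intro ext restrict_ext DG)
    also have "distr M (\<Pi>\<^sub>M i\<in>{0..n}. borel) (\<lambda>\<omega>. \<lambda>i\<in>{0..n}. ?D X i \<omega>) =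
        (\<Pi>\<^sub>M i\<in>{0..n}. distr M borel (?D X i))"
      using independent_increments[OF \<tau>]
      by (subst indep_vars_iff_distr_eq_PiM'[symmetric]) (use DX in auto)
    also have "\<dots> = (\<Pi>\<^sub>M i\<in>{0..n}. distr N borel (?D Y i))"
    proof (rule PiM_cong[OF refl])
      fix i assume i: "i \<in> {0..n}"
      show "distr M borel (?D X i) = distr N borel (?D Y i)"
        unfolding distr_N[OF DY0[OF i]] DG[OF i] ..
    qed
    finally have "distr N (\<Pi>\<^sub>M i\<in>{0..n}. borel) (\<lambda>p. \<lambda>i\<in>{0..n}. ?D Y i p) =
        (\<Pi>\<^sub>M i\<in>{0..n}. distr N borel (?D Y i))" .
    moreover have "?D Y i \<in> borel_measurable N" if "i \<in> {0..n}" for i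
      using DY0[OF that] unfolding N_def by simp
    ultimately show "N.indep_vars (\<lambda>_. borel) (?D Y) {0..n}"
      using N.indep_vars_iff_distr_eq_PiM'[where I = "{0..n}" and X = "?D Y" and M' = "\<lambda>_. borel"]
      by (simp del: One_nat_def)
  qed
  show ?thesis
  proof (rule that[OF sub])
    have "(\<lambda>p. \<lambda>\<tau>\<in>{0..}. Y \<tau> p) \<in> measurable N0 (\<Pi>\<^sub>M \<tau>\<in>{0..}. borel)"
      using Y0 by (rule process_map_measurable)
    moreover have "(\<lambda>\<tau>\<in>{0..}. Y \<tau> (G \<omega>)) = (\<lambda>\<tau>\<in>{0..}. X \<tau> \<omega>)" for \<omega>
      by (rule restrict_ext) (simp add: YG)
    ultimately show "process_law N Y = process_law M X"
      unfolding process_law_def N_def by (subst distr_distr[OF _ G]) (simp_all add: comp_def)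
    show "AE p in N. Y 0 p = c" if "AE \<omega> in M. X 0 \<omega> = c" for c
      unfolding N_def
    proof (subst AE_distr_iff[OF G])
      have [measurable]: "Y 0 \<in> borel_measurable N0" by (rule Y0) simp
      show "{p \<in> space N0. Y 0 p = c} \<in> sets N0" by measurable
      show "AE \<omega> in M. Y 0 (G \<omega>) = c" using that by (simp add: YG)
    qed
    show "(LINT p|N. exp (- t * (Y \<tau> p - Y \<sigma> p))) = (LINT \<omega>|M. exp (- t * (X \<tau> \<omega> - X \<sigma> \<omega>)))"
      if "0 \<le> \<sigma>" "\<sigma> \<le> \<tau>" for t \<sigma> \<tau>
    proof -
      have [measurable]: "Y \<tau> \<in> borel_measurable N0" "Y \<sigma> \<in> borel_measurable N0"
        using that by (auto intro: Y0)
      show ?thesis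
        unfolding N_def using that by (subst integral_distr[OF G]) (simp_all add: YG)
    qed
  qed
qed

lemma deterministic_start_lawsI:
  fixes M :: "'w measure"
  assumes "subordinator M X" "0 \<le> c" "AE \<omega> in M. X 0 \<omega> = c"
  shows "process_law M X \<in> deterministic_start_laws"
proof -
  obtain N :: "(real \<Rightarrow> real) measure" and Y where "subordinator N Y" "process_law N Y = process_law M X"
      "\<And>c. AE \<omega> in M. X 0 \<omega> = c \<Longrightarrow> AE p in N. Y 0 p = c"
    by (rule exists_path_space_version[OF assms(1)]) (use that in blast)
  note N = this
  have "\<exists>c\<ge>0. AE p in N. Y 0 p = c"
    using N(3)[OF assms(3)] assms(2) by blast
  then show ?thesis
    unfolding deterministic_start_laws_def using N(1) N(2)[symmetric] by blast
qed

lemma associated_lawI: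
  fixes M :: "'w measure"
  assumes "associated_process f M X"
  shows "associated_law f (process_law M X)"
proof -
  obtain L K \<nu> where sub: "subordinator M X" and f: "impulse_response_form L K \<nu> f"
    and L: "AE \<omega> in M. X 0 \<omega> = L"
    and lap: "\<And>t \<sigma> \<tau>. 0 \<le> t \<Longrightarrow> 0 \<le> \<sigma> \<Longrightarrow> \<sigma> \<le> \<tau> \<Longrightarrow>
      (LINT \<omega>|M. exp (- t * (X \<tau> \<omega> - X \<sigma> \<omega>))) = exp (- (\<tau> - \<sigma>) * (f t - L))"
    using assms unfolding associated_process_def by blast
  show ?thesis
  proof (rule exists_path_space_version[OF sub])
    fix N :: "(real \<Rightarrow> real) measure" and Y
    assume N: "subordinator N Y" "process_law N Y = process_law M X"
      "\<And>c. AE \<omega> in M. X 0 \<omega> = c \<Longrightarrow> AE p in N. Y 0 p = c"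
      "\<And>t \<sigma> \<tau>. 0 \<le> \<sigma> \<Longrightarrow> \<sigma> \<le> \<tau> \<Longrightarrow>
       (LINT p|N. exp (- t * (Y \<tau> p - Y \<sigma> p))) = (LINT \<omega>|M. exp (- t * (X \<tau> \<omega> - X \<sigma> \<omega>)))"
    have "(LINT p|N. exp (- t * (Y \<tau> p - Y \<sigma> p))) = exp (- (\<tau> - \<sigma>) * (f t - L))"
      if "0 \<le> t" "0 \<le> \<sigma>" "\<sigma> \<le> \<tau>" for t \<sigma> \<tau>
      using N(4)[OF that(2,3)] lap[OF that] by (rule trans)
    then have "associated_process f N Y"
      unfolding associated_process_def using N(1) f N(3)[OF L] by blast
    then show ?thesis
      unfolding associated_law_def using N(2)[symmetric] by blast
  qed
qed

end

theory Submission
  imports Defs "HOL-Real_Asymp.Real_Asymp"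
begin

text \<open>An impulse response \<open>f\<close> and the law it should be sent to are linked by Laplace transforms: the law is
asked to start at \<open>f 0 = L\<close> and to have increments with Laplace transform \<open>exp (- s (f t - f 0))\<close> over
any time span \<open>s\<close>. A law on the half-line is determined by its Laplace transform
(\<open>finite_measure_eqI_Laplace\<close>), and the finite-dimensional distributions of a subordinator are
images of products of the laws of its start and increments, so at most one law belongs to \<open>f\<close>
(\<open>process_law_eqI_Laplace\<close>). Conversely the law determines \<open>f 0\<close> and the transform of the increment
over \<open>[0, 1]\<close>, hence \<open>f\<close>, which gives injectivity.

Existence is the Levy--Ito construction. Scatter a Poisson cloud of points \<open>(s, x)\<close> over the half
plane with intensity \<open>ds \<otimes> \<nu>\<close> and let the process at time \<open>\<tau>\<close> be \<open>L + K \<tau>\<close> plus the sum of all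
jumps \<open>x\<close> with \<open>0 < s \<le> \<tau>\<close>. Everything needed follows from one formula for the cloud
(\<open>exists_poisson_process\<close>): the sum of a function \<open>h \<ge> 0\<close> over the points has Laplace transform
\<open>exp (- \<integral> (1 - exp (- h)))\<close>. For \<open>h (s, x) = w s * x\<close> with a step function \<open>w\<close> this exhibits the joint
transform of several increments as a product, and a joint transform that factorises means
independence (\<open>indep_vars_Laplace\<close>).

Surjectivity is the Levy--Khintchine formula. Independent stationary increments and monotone paths
force the increment over a span \<open>s\<close> to have transform \<open>exp (- s \<phi> t)\<close> for some \<open>\<phi>\<close>
(\<open>Laplace_increment\<close>), so the increment over \<open>1 / n\<close> is an \<open>n\<close>-th convolution root. Weighting its law
with \<open>n (1 - exp (- x))\<close> and moving it to \<open>[0, 1]\<close> by \<open>u = exp (- x)\<close> gives measures that have a weak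
limit point by compactness; the mass of the limit at \<open>u = 1\<close> is the drift \<open>K\<close>, its part in \<open>(0, 1)\<close> is
the Levy measure, and there is no mass at \<open>u = 0\<close>, which corresponds to killing, because \<open>\<phi>\<close> tends
to \<open>0\<close> at \<open>0\<close> (\<open>infinitely_divisible_exponent\<close>).\<close>

section \<open>Laplace transforms of laws on the half-line\<close>

text \<open>The map \<open>x \<mapsto> exp (- x)\<close> carries the half-line into \<open>[0, 1]\<close>, and the Laplace transform at the integers
becomes the sequence of moments there. Bernstein polynomials then identify the integrals of all
bounded continuous functions, in particular of \<open>cos\<close> and \<open>sin\<close>, and the characteristic function
determines the distribution.\<close>
lemma real_distribution_eqI_Laplace:
  fixes M N :: "real measure"
  assumes "real_distribution M" "real_distribution N"
    and posM: "AE x in M. 0 \<le> x" and posN: "AE x in N. 0 \<le> x"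
    and lap: "\<And>t. 0 \<le> t \<Longrightarrow> (LINT x|M. exp (- t * x)) = (LINT x|N. exp (- t * x))"
  shows "M = N"
proof -
  define E where "E P = distr P borel (\<lambda>x::real. exp (- x))" for P :: "real measure"
  interpret M: real_distribution M by fact
  interpret N: real_distribution N by fact
  have E_dist: "real_distribution (E P)" if "real_distribution P" for P
  proof -
    interpret P: real_distribution P by fact
    show ?thesis unfolding E_def by simp
  qed
  have E_int: "(LINT u|E P. f u) = (LINT x|P. f (exp (- x)))"
    if "real_distribution P" "f \<in> borel_measurable borel" for P and f :: "real \<Rightarrow> real"
  proof -
    interpret P: real_distribution P by fact
    show ?thesis using that(2) by (simp add: E_def integral_distr)
  qed
  have pow: "(LINT u|E M. u ^ n) = (LINT u|E N. u ^ n)" for n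
    using lap[of "real n"] assms(1,2)
    by (simp add: E_int exp_of_nat_mult[symmetric])
  have E_ae: "AE u in E P. u \<in> {0..1}" if "real_distribution P" "AE x in P. 0 \<le> x" for P
  proof -
    interpret P: real_distribution P by fact
    show ?thesis using that(2) unfolding E_def by (subst AE_distr_iff) auto
  qed
  have ae: "AE u in E M. u \<in> {0..1}" "AE u in E N. u \<in> {0..1}"
    using E_ae assms by auto
  interpret EM: real_distribution "E M" by (rule E_dist) fact
  interpret EN: real_distribution "E N" by (rule E_dist) fact
  have cont: "(LINT u|E M. f u) = (LINT u|E N. f u)"
    if f: "continuous_on UNIV f" and B: "\<And>u. \<bar>f u\<bar> \<le> B" for f :: "real \<Rightarrow> real" and B
  proof -
    have fm [measurable]: "f \<in> borel_measurable borel"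
      using f by (rule borel_measurable_continuous_onI)
    have close: "\<exists>p. p \<in> borel_measurable borel \<and> integrable (E M) p \<and> integrable (E N) p \<and>
       (LINT u|E M. p u) = (LINT u|E N. p u) \<and> (\<forall>u\<in>{0..1}. \<bar>f u - p u\<bar> \<le> e)" if "0 < e" for e
    proof -
      obtain n where n: "\<And>u. u \<in> {0..1} \<Longrightarrow> \<bar>f u - (\<Sum>k\<le>n. f (k/n) * Bernstein n k u)\<bar> < e"
        using Bernstein_Weierstrass[of f, OF _ \<open>0 < e\<close>] f continuous_on_subset by blast
      define p where "p u = (\<Sum>k\<le>n. f (k/n) * Bernstein n k u)" for u
      define P where "P = (\<Sum>k\<le>n. smult (f (k/n) * real (n choose k)) (monom 1 k * [:1, -1:]^(n - k)))"
      have pP: "p u = poly P u" for u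
        by (simp add: p_def P_def poly_sum poly_monom Bernstein_def algebra_simps)
      have pw: "p u = (\<Sum>i\<le>degree P. coeff P i * u ^ i)" for u
        by (simp add: pP poly_altdef)
      have int: "integrable Q (\<lambda>u. u ^ i)" if "real_distribution Q" "AE u in Q. u \<in> {0..1}" for Q i
      proof -
        interpret Q: real_distribution Q by fact
        show ?thesis
          by (rule Q.integrable_const_bound[where B=1])
            (use that(2) in \<open>auto simp: power_le_one elim: eventually_elim2\<close>)
      qed
      note iM = int[OF EM.real_distribution_axioms ae(1)] and iN = int[OF EN.real_distribution_axioms ae(2)]
      have "p \<in> borel_measurable borel" unfolding pw[abs_def] by measurable
      moreover have "integrable (E M) p" "integrable (E N) p"
        unfolding pw[abs_def] using iM iN by auto
      moreover have "(LINT u|E M. p u) = (LINT u|E N. p u)"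
        unfolding pw using iM iN pow by simp
      ultimately show ?thesis using n[folded p_def] less_imp_le by blast
    qed
    have "\<bar>(LINT u|E M. f u) - (LINT u|E N. f u)\<bar> \<le> e" if "0 < e" for e
    proof -
      obtain p where p [measurable]: "p \<in> borel_measurable borel" and ip: "integrable (E M) p" "integrable (E N) p"
        and eq: "(LINT u|E M. p u) = (LINT u|E N. p u)" and d: "\<forall>u\<in>{0..1}. \<bar>f u - p u\<bar> \<le> e / 2"
        using close[OF half_gt_zero[OF \<open>0 < e\<close>]] by blast
      have one: "\<bar>(LINT u|Q. f u) - (LINT u|Q. p u)\<bar> \<le> e / 2"
        if "real_distribution Q" "AE u in Q. u \<in> {0..1}" "integrable Q p" for Q
      proof -
        interpret Q: real_distribution Q by fact
        have iff: "integrable Q f"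
          by (rule Q.integrable_const_bound[where B=B]) (use B in auto)
        have "\<bar>(LINT u|Q. f u) - (LINT u|Q. p u)\<bar> = \<bar>LINT u|Q. f u - p u\<bar>"
          using iff that(3) by simp
        also have "\<dots> \<le> (LINT u|Q. \<bar>f u - p u\<bar>)" by (rule integral_abs_bound)
        also have "\<dots> \<le> (LINT u|Q. e / 2)"
          using iff that(3) by (intro integral_mono_AE eventually_mono[OF that(2)]) (use d in auto)
        finally show ?thesis using Q.prob_space by simp
      qed
      show ?thesis
        using one[OF EM.real_distribution_axioms ae(1) ip(1)] one[OF EN.real_distribution_axioms ae(2) ip(2)] eq
        by linarith
    qed
    then have "\<bar>(LINT u|E M. f u) - (LINT u|E N. f u)\<bar> \<le> 0"
      by (rule field_le_epsilon) auto
    then show ?thesis by simp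
  qed
  have "char (E M) = char (E N)"
  proof
    fix t
    have I: "integrable (E M) (\<lambda>u. iexp (t * u))" "integrable (E N) (\<lambda>u. iexp (t * u))"
      by (auto intro!: EM.integrable_const_bound[where B=1] EN.integrable_const_bound[where B=1])
    have "(LINT u|E M. cos (t * u)) = (LINT u|E N. cos (t * u))"
      "(LINT u|E M. sin (t * u)) = (LINT u|E N. sin (t * u))"
      by (auto intro!: cont[of _ 1] continuous_intros)
    then show "char (E M) t = char (E N) t"
      unfolding char_def complex_eq_iff using I
      by (simp add: integral_Re[symmetric] integral_Im[symmetric] Re_exp Im_exp del: integral_Re integral_Im)
  qed
  then have "E M = E N" by (intro Levy_uniqueness EM.real_distribution_axioms EN.real_distribution_axioms)
  moreover have "distr (E P) borel (\<lambda>u. - ln u) = P" if "real_distribution P" for P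
  proof -
    interpret P: real_distribution P by fact
    have "distr (E P) borel (\<lambda>u. - ln u) = distr P borel (\<lambda>x. x)"
      unfolding E_def by (subst distr_distr) (auto simp: comp_def)
    also have "\<dots> = P" by (rule distr_id2) simp
    finally show ?thesis .
  qed
  ultimately show ?thesis using assms(1,2) by metis
qed

text \<open>Total masses are not normalised, since the independence criterion compares the measures
\<open>B \<mapsto> E[1\<^sub>B(Y) W]\<close> for weights \<open>W\<close> whose expectation may vanish.\<close>
lemma finite_measure_eqI_Laplace:
  fixes M N :: "real measure"
  assumes "finite_measure M" "finite_measure N"
    and [measurable_cong]: "sets M = sets borel" "sets N = sets borel"
    and posM: "AE x in M. 0 \<le> x" and posN: "AE x in N. 0 \<le> x"
    and lap: "\<And>t. 0 \<le> t \<Longrightarrow> (LINT x|M. exp (- t * x)) = (LINT x|N. exp (- t * x))"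
  shows "M = N"
proof -
  interpret M: finite_measure M by fact
  interpret N: finite_measure N by fact
  define c where "c = measure M (space M)"
  have cN: "c = measure N (space N)" using lap[of 0] by (simp add: c_def)
  have sp: "space M = UNIV" "space N = UNIV" using assms(3,4)[THEN sets_eq_imp_space_eq] by auto
  have eM: "emeasure M (space M) = ennreal c" "emeasure N (space N) = ennreal c"
    by (simp_all add: c_def M.emeasure_eq_measure) (simp add: cN[unfolded c_def] N.emeasure_eq_measure)
  show ?thesis
  proof (cases "c = 0")
    case True
    then have "emeasure M A = 0" "emeasure N A = 0" for A
      using emeasure_space[of M A] emeasure_space[of N A] eM by auto
    then show ?thesis by (intro measure_eqI) (simp_all add: assms)
  next
    case False
    then have c: "c > 0" by (simp add: c_def zero_less_measure_iff measure_le_0_iff less_le)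
    let ?S = "\<lambda>P. density P (\<lambda>_. ennreal (1 / c))"
    have dist: "real_distribution (?S P)"
      if "emeasure P (space P) = ennreal c" "sets P = sets borel" for P
    proof -
      have "prob_space (?S P)"
      proof (rule prob_spaceI)
        have "emeasure (?S P) (space P) = (\<integral>\<^sup>+x. ennreal (1 / c) * indicator (space P) x \<partial>P)"
          by (rule emeasure_density) auto
        also have "\<dots> = ennreal (1 / c) * emeasure P (space P)"
          by (rule nn_integral_cmult_indicator) simp
        also have "\<dots> = 1" using c that by (simp add: ennreal_mult[symmetric])
        finally show "emeasure (?S P) (space (?S P)) = 1" by simp
      qed
      then show ?thesis using that by (simp add: real_distribution_def real_distribution_axioms_def)
    qed
    have "?S M = ?S N"
    proof (rule real_distribution_eqI_Laplace)
      show "AE x in ?S M. 0 \<le> x" "AE x in ?S N. 0 \<le> x"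
        using posM posN by (auto simp: AE_density)
      show "(LINT x|?S M. exp (- t * x)) = (LINT x|?S N. exp (- t * x))" if "0 \<le> t" for t
        using lap[OF that] c by (simp add: integral_density)
    qed (auto intro!: dist eM assms)
    then have "density (?S M) (\<lambda>_. ennreal c) = density (?S N) (\<lambda>_. ennreal c)" by simp
    then show ?thesis using c
      by (simp add: density_density_eq ennreal_mult[symmetric] density_1)
  qed
qed

lemma distr_eqI_Laplace:
  fixes Y :: "'a \<Rightarrow> real" and Y' :: "'b \<Rightarrow> real"
  assumes "prob_space M" "prob_space N"
    and [measurable]: "Y \<in> borel_measurable M" "Y' \<in> borel_measurable N"
    and nonneg: "AE \<omega> in M. 0 \<le> Y \<omega>" "AE \<omega> in N. 0 \<le> Y' \<omega>"
    and lap: "\<And>t. 0 \<le> t \<Longrightarrow> (LINT \<omega>|M. exp (- t * Y \<omega>)) = (LINT \<omega>|N. exp (- t * Y' \<omega>))"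
  shows "distr M borel Y = distr N borel Y'"
proof -
  interpret M: prob_space M by fact
  interpret N: prob_space N by fact
  interpret DM: prob_space "distr M borel Y" by (rule M.prob_space_distr) simp
  interpret DN: prob_space "distr N borel Y'" by (rule N.prob_space_distr) simp
  show ?thesis
  proof (rule finite_measure_eqI_Laplace)
    show "AE x in distr M borel Y. 0 \<le> x" "AE x in distr N borel Y'. 0 \<le> x"
      using nonneg by (simp_all add: AE_distr_iff)
    show "(LINT x|distr M borel Y. exp (- t * x)) = (LINT x|distr N borel Y'. exp (- t * x))" if "0 \<le> t" for t
      using lap[OF that] by (simp add: integral_distr)
  qed (simp_all add: DM.finite_measure_axioms DN.finite_measure_axioms)
qed

text \<open>The factors \<open>exp (- t i * Y i)\<close> are exchanged for indicators of \<open>Y i \<in> A i\<close> one coordinate at a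
time. While the other factors are held fixed, both sides of the product formula are, as functions
of the remaining parameter \<open>t j\<close>, Laplace transforms of finite measures, so these measures agree
and may be evaluated at \<open>A j\<close>.\<close>
lemma (in prob_space) indep_vars_Laplace:
  fixes Y :: "'i \<Rightarrow> 'a \<Rightarrow> real"
  assumes I: "finite I" "I \<noteq> {}"
    and Y [measurable]: "\<And>i. i \<in> I \<Longrightarrow> Y i \<in> borel_measurable M"
    and nonneg: "\<And>i. i \<in> I \<Longrightarrow> AE \<omega> in M. 0 \<le> Y i \<omega>"
    and lap: "\<And>t. (\<And>i. i \<in> I \<Longrightarrow> 0 \<le> t i) \<Longrightarrow>
      (LINT \<omega>|M. (\<Prod>i\<in>I. exp (- t i * Y i \<omega>))) = (\<Prod>i\<in>I. LINT \<omega>|M. exp (- t i * Y i \<omega>))"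
  shows "indep_vars (\<lambda>_. borel) Y I"
proof -
  define g where "g S A t i \<omega> = (if i \<in> S then indicator (A i) (Y i \<omega>) else exp (- t i * Y i \<omega>))"
    for S :: "'i set" and A :: "'i \<Rightarrow> real set" and t :: "'i \<Rightarrow> real" and i \<omega>
  have g0: "0 \<le> g S A t i \<omega>" for S A t i \<omega> by (simp add: g_def)
  have g1: "AE \<omega> in M. g S A t i \<omega> \<le> 1" if "i \<in> I" "0 \<le> t i" for S A t i
    using nonneg[OF that(1)] by eventually_elim (use that(2) in \<open>auto simp: g_def\<close>)
  have gm: "g S A t i \<in> borel_measurable M" if "i \<in> I" "A i \<in> sets borel" for S A t i
  proof -
    have [measurable]: "Y i \<in> borel_measurable M" "A i \<in> sets borel" using that by auto
    show ?thesis unfolding g_def[abs_def] by (cases "i \<in> S") auto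
  qed
  \<comment> \<open>\<open>S\<close> is the set of coordinates at which the exchange has been made\<close>
  have claim: "(LINT \<omega>|M. (\<Prod>i\<in>I. g S A t i \<omega>)) = (\<Prod>i\<in>I. LINT \<omega>|M. g S A t i \<omega>)"
    if "finite S" "S \<subseteq> I" "\<And>i. i \<in> I \<Longrightarrow> A i \<in> sets borel" "\<And>i. i \<in> I \<Longrightarrow> 0 \<le> t i" for S A t
    using that
  proof (induction S arbitrary: t rule: finite_induct)
    case empty
    then show ?case using lap[of t] by (simp add: g_def)
  next
    case (insert j S)
    then have j: "j \<in> I" "j \<notin> S" by auto
    have [measurable]: "Y j \<in> borel_measurable M" "A j \<in> sets borel" using j insert.prems by auto
    define W where "W \<omega> = (\<Prod>i\<in>I-{j}. g S A t i \<omega>)" for \<omega>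
    define C where "C = (\<Prod>i\<in>I-{j}. LINT \<omega>|M. g S A t i \<omega>)"
    have W0: "0 \<le> W \<omega>" for \<omega> by (auto simp: W_def intro!: prod_nonneg g0)
    have C0: "0 \<le> C" by (auto simp: C_def intro!: prod_nonneg Bochner_Integration.integral_nonneg g0)
    have Wm [measurable]: "W \<in> borel_measurable M"
      unfolding W_def[abs_def] using insert.prems by (intro borel_measurable_prod gm) auto
    have W1: "AE \<omega> in M. W \<omega> \<le> 1"
    proof -
      have "AE \<omega> in M. \<forall>i\<in>I-{j}. g S A t i \<omega> \<le> 1"
        using I insert.prems by (intro AE_finite_allI g1) auto
      then show ?thesis unfolding W_def
        by eventually_elim (auto intro!: prod_le_1 g0)
    qed
    have Wi: "integrable M W"
      by (rule integrable_const_bound[where B=1]) (use W0 W1 in auto)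
    have split: "(\<Prod>i\<in>I. g S' A t' i \<omega>) = g S' A t' j \<omega> * W \<omega>"
      and splitE: "(\<Prod>i\<in>I. LINT \<omega>|M. g S' A t' i \<omega>) = (LINT \<omega>|M. g S' A t' j \<omega>) * C"
      if "S' - {j} = S - {j}" "\<And>i. i \<noteq> j \<Longrightarrow> t' i = t i" for S' t' \<omega>
    proof -
      have *: "g S' A t' i = g S A t i" if "i \<in> I - {j}" for i
      proof -
        have "i \<in> S' \<longleftrightarrow> i \<in> S" "t' i = t i"
          using that \<open>S' - {j} = S - {j}\<close> \<open>\<And>i. i \<noteq> j \<Longrightarrow> t' i = t i\<close> by auto
        then show ?thesis by (auto simp: g_def fun_eq_iff)
      qed
      show "(\<Prod>i\<in>I. g S' A t' i \<omega>) = g S' A t' j \<omega> * W \<omega>"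
        "(\<Prod>i\<in>I. LINT \<omega>|M. g S' A t' i \<omega>) = (LINT \<omega>|M. g S' A t' j \<omega>) * C"
        unfolding W_def C_def using I(1) j(1) * by (simp_all add: prod.remove)
    qed
    have IH: "(LINT \<omega>|M. exp (- s * Y j \<omega>) * W \<omega>) = (LINT \<omega>|M. exp (- s * Y j \<omega>)) * C" if "0 \<le> s" for s
    proof -
      have "(LINT \<omega>|M. (\<Prod>i\<in>I. g S A (t(j := s)) i \<omega>)) = (\<Prod>i\<in>I. LINT \<omega>|M. g S A (t(j := s)) i \<omega>)"
        using insert.prems that by (intro insert.IH) auto
      then have "(LINT \<omega>|M. g S A (t(j := s)) j \<omega> * W \<omega>) = (LINT \<omega>|M. g S A (t(j := s)) j \<omega>) * C"
        by (simp add: split[of S "t(j := s)"] splitE[of S "t(j := s)"])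
      then show ?thesis using j by (simp add: g_def)
    qed
    define \<alpha> where "\<alpha> = distr (density M (\<lambda>\<omega>. ennreal (W \<omega>))) borel (Y j)"
    define \<beta> where "\<beta> = distr (density M (\<lambda>\<omega>. ennreal C)) borel (Y j)"
    have fin: "finite_measure (distr (density M (\<lambda>\<omega>. ennreal (V \<omega>))) borel (Y j))"
      if "integrable M V" "\<And>\<omega>. 0 \<le> V \<omega>" for V
    proof (rule finite_measureI)
      have [measurable]: "V \<in> borel_measurable M" using that by auto
      have "(\<integral>\<^sup>+\<omega>. ennreal (V \<omega>) \<partial>M) < \<infinity>"
        using that by (simp add: nn_integral_eq_integral)
      then show "emeasure (distr (density M (\<lambda>\<omega>. ennreal (V \<omega>))) borel (Y j))
          (space (distr (density M (\<lambda>\<omega>. ennreal (V \<omega>))) borel (Y j))) \<noteq> \<infinity>"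
        by (simp add: emeasure_distr emeasure_density space_density cong: nn_integral_cong_simp)
    qed
    have int\<alpha>: "(LINT x|\<alpha>. h x) = (LINT \<omega>|M. h (Y j \<omega>) * W \<omega>)"
      and int\<beta>: "(LINT x|\<beta>. h x) = (LINT \<omega>|M. h (Y j \<omega>)) * C"
      if [measurable]: "h \<in> borel_measurable borel" for h :: "real \<Rightarrow> real"
      unfolding \<alpha>_def \<beta>_def using W0 C0
      by (simp_all add: integral_distr integral_density mult.commute)
    have "\<alpha> = \<beta>"
    proof (rule finite_measure_eqI_Laplace)
      show "finite_measure \<alpha>" "finite_measure \<beta>"
        unfolding \<alpha>_def \<beta>_def using W0 C0 Wi by (auto intro!: fin)
      show "AE x in \<alpha>. 0 \<le> x" "AE x in \<beta>. 0 \<le> x"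
        unfolding \<alpha>_def \<beta>_def using nonneg[OF j(1)] by (auto simp: AE_distr_iff AE_density elim!: eventually_mono)
      show "(LINT x|\<alpha>. exp (- t * x)) = (LINT x|\<beta>. exp (- t * x))" if "0 \<le> t" for t
        using IH[OF that] by (simp add: int\<alpha> int\<beta>)
    qed (simp_all add: \<alpha>_def \<beta>_def)
    then have "(LINT \<omega>|M. indicator (A j) (Y j \<omega>) * W \<omega>) = (LINT \<omega>|M. indicator (A j) (Y j \<omega>)) * C"
      using int\<alpha>[of "indicator (A j)"] int\<beta>[of "indicator (A j)"] by simp
    then show ?case
      by (simp add: split[of "insert j S" t] splitE[of "insert j S" t]) (simp add: g_def)
  qed
  show ?thesis
  proof (subst indep_vars_finite[OF I(2,1), where E="\<lambda>_. sets borel"])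
    show "sets borel = sigma_sets (space borel) (sets (borel :: real measure))"
      by (rule sets.sigma_sets_eq[symmetric])
    show "Int_stable (sets (borel :: real measure))" by (rule sets.Int_stable)
    show "\<forall>A\<in>I \<rightarrow> sets borel. prob (\<Inter>j\<in>I. Y j -` A j \<inter> space M) = (\<Prod>j\<in>I. prob (Y j -` A j \<inter> space M))"
    proof
      fix A :: "'i \<Rightarrow> real set" assume A: "A \<in> I \<rightarrow> sets borel"
      have ev: "Y j -` A j \<inter> space M \<in> events" if "j \<in> I" for j
        by (rule measurable_sets[OF Y[OF that]]) (use A that in auto)
      have "prob (\<Inter>j\<in>I. Y j -` A j \<inter> space M) = (LINT \<omega>|M. indicator (\<Inter>j\<in>I. Y j -` A j \<inter> space M) \<omega>)"
        using I ev by (simp add: sets.finite_INT Int_absorb2 sets.sets_into_space)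
      also have "\<dots> = (LINT \<omega>|M. (\<Prod>i\<in>I. g I A (\<lambda>_. 0) i \<omega>))"
      proof (rule Bochner_Integration.integral_cong[OF refl])
        fix \<omega> assume \<omega>: "\<omega> \<in> space M"
        have "indicator (\<Inter>j\<in>I. Y j -` A j \<inter> space M) \<omega> = (\<Prod>i\<in>I. indicator (A i) (Y i \<omega>) :: real)"
        proof (cases "\<forall>j\<in>I. Y j \<omega> \<in> A j")
          case True
          then show ?thesis using \<omega> I by (auto simp: indicator_def)
        next
          case False
          then have "(\<Prod>i\<in>I. indicator (A i) (Y i \<omega>) :: real) = 0" using I by (auto simp: indicator_def)
          then show ?thesis using False by (auto simp: indicator_def)
        qed
        then show "indicator (\<Inter>j\<in>I. Y j -` A j \<inter> space M) \<omega> = (\<Prod>i\<in>I. g I A (\<lambda>_. 0) i \<omega>)"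
          by (simp add: g_def)
      qed
      also have "\<dots> = (\<Prod>i\<in>I. LINT \<omega>|M. g I A (\<lambda>_. 0) i \<omega>)"
        using A I by (intro claim) auto
      also have "\<dots> = (\<Prod>j\<in>I. prob (Y j -` A j \<inter> space M))"
      proof (rule prod.cong[OF refl])
        fix j assume j: "j \<in> I"
        have "(LINT \<omega>|M. g I A (\<lambda>_. 0) j \<omega>) = (LINT \<omega>|M. indicator (Y j -` A j \<inter> space M) \<omega>)"
          using j by (intro Bochner_Integration.integral_cong) (auto simp: g_def indicator_def)
        then show "(LINT \<omega>|M. g I A (\<lambda>_. 0) j \<omega>) = prob (Y j -` A j \<inter> space M)"
          using ev[OF j] by (simp add: Int_absorb2 sets.sets_into_space)
      qed
      finally show "prob (\<Inter>j\<in>I. Y j -` A j \<inter> space M) = (\<Prod>j\<in>I. prob (Y j -` A j \<inter> space M))" .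
    qed
  qed (use Y sets.space_closed in \<open>auto\<close>)
qed

section \<open>The law of a subordinator is determined by its increments\<close>

context subordinator
begin

lemma measurable_increment:
  "0 \<le> \<sigma> \<Longrightarrow> \<sigma> \<le> \<tau> \<Longrightarrow> (\<lambda>\<omega>. X \<tau> \<omega> - X \<sigma> \<omega>) \<in> borel_measurable M"
  using measurable_X[of \<sigma>] measurable_X[of \<tau>] by simp

lemma increment_nonneg:
  "0 \<le> \<sigma> \<Longrightarrow> \<sigma> \<le> \<tau> \<Longrightarrow> \<omega> \<in> space M \<Longrightarrow> 0 \<le> X \<tau> \<omega> - X \<sigma> \<omega>"
  using mono_onD[OF mono_paths, of \<omega> \<sigma> \<tau>] by auto

end

lemma finite_time_grid:
  fixes J :: "real set"
  assumes J: "finite J" "J \<subseteq> {0..}"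
  shows "\<exists>(n::nat) \<tau> idx. \<tau> 0 = 0 \<and> strict_mono_on {0..n} \<tau> \<and> (\<forall>j\<in>J. idx j \<le> n \<and> \<tau> (idx j) = j)"
proof -
  define S where "S = sorted_list_of_set (insert 0 J)"
  have S: "sorted S" "distinct S" "set S = insert 0 J"
    using J by (simp_all add: S_def del: sorted_list_of_set_insert_remove)
  then have len: "0 < length S" by (cases S) auto
  have idx: "\<exists>i. i \<le> length S - 1 \<and> S ! i = j" if "j \<in> insert 0 J" for j
  proof -
    obtain i where "i < length S" "S ! i = j" using \<open>j \<in> insert 0 J\<close> unfolding S(3)[symmetric] in_set_conv_nth by blast
    then show ?thesis by (intro exI[of _ i]) auto
  qed
  have "S ! 0 = 0"
  proof -
    obtain i where i: "i \<le> length S - 1" "S ! i = 0" using idx[of 0] by blast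
    have "i < length S" using i(1) len by linarith
    then have "S ! 0 \<le> S ! i" by (intro sorted_nth_mono[OF S(1)]) simp_all
    then have "S ! 0 \<le> 0" by (simp only: i(2))
    moreover have "S ! 0 \<in> insert 0 J" using nth_mem[OF len] by (simp only: S(3))
    ultimately show ?thesis using J(2) by auto
  qed
  moreover have "strict_mono_on {0..length S - 1} ((!) S)"
  proof (rule strict_mono_onI)
    fix r s assume "r \<in> {0..length S - 1}" "s \<in> {0..length S - 1}" "r < s"
    then have "s < length S" using len by auto
    then have "S ! r \<le> S ! s" "S ! r \<noteq> S ! s"
      using sorted_nth_mono[OF S(1), of r s] nth_eq_iff_index_eq[OF S(2), of r s] \<open>r < s\<close> by simp_all
    then show "S ! r < S ! s" by simp
  qed
  moreover obtain f where "\<forall>j\<in>insert 0 J. f j \<le> length S - 1 \<and> S ! f j = j"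
    using bchoice[of "insert 0 J" "\<lambda>j i. i \<le> length S - 1 \<and> S ! i = j"] idx by blast
  ultimately show ?thesis
    by (intro exI[of _ "length S - 1"] exI[of _ "(!) S"] exI[of _ f]) auto
qed

text \<open>Along a time grid containing a given finite set of times and starting at \<open>0\<close>, the values of the
process are partial sums of its start and its increments. These are independent, so their joint
law is the product of laws which the Laplace transforms determine.\<close>
lemma process_law_eqI_Laplace:
  fixes M :: "'a measure" and N :: "'b measure"
  assumes subM: "subordinator M X" and subN: "subordinator N Y"
    and X0: "AE \<omega> in M. X 0 \<omega> = c" and Y0: "AE \<omega> in N. Y 0 \<omega> = c"
    and lap: "\<And>t \<sigma> \<tau>. 0 \<le> t \<Longrightarrow> 0 \<le> \<sigma> \<Longrightarrow> \<sigma> \<le> \<tau> \<Longrightarrow>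
      (LINT \<omega>|M. exp (- t * (X \<tau> \<omega> - X \<sigma> \<omega>))) = (LINT \<omega>|N. exp (- t * (Y \<tau> \<omega> - Y \<sigma> \<omega>)))"
  shows "process_law M X = process_law N Y"
proof -
  interpret M: subordinator M X by fact
  interpret N: subordinator N Y by fact
  have iff: "process_law M X = process_law N Y \<longleftrightarrow> (\<forall>J. finite J \<and> J \<subseteq> {0..} \<longrightarrow>
      distr M (\<Pi>\<^sub>M \<tau>\<in>J. borel) (\<lambda>\<omega>. \<lambda>\<tau>\<in>J. X \<tau> \<omega>) = distr N (\<Pi>\<^sub>M \<tau>\<in>J. borel) (\<lambda>\<omega>. \<lambda>\<tau>\<in>J. Y \<tau> \<omega>))"
    by (rule process_law_eq_iff[OF M.prob_space_axioms N.prob_space_axioms M.measurable_X N.measurable_X])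
  show ?thesis
    unfolding iff
  proof (intro allI impI)
    fix J :: "real set" assume J: "finite J \<and> J \<subseteq> {0..}"
    obtain n :: nat and \<tau> idx where grid: "\<tau> 0 = 0 \<and> strict_mono_on {0..n} \<tau> \<and> (\<forall>j\<in>J. idx j \<le> n \<and> \<tau> (idx j) = j)"
      using finite_time_grid[OF conjunct1[OF J] conjunct2[OF J]] by (elim exE) (rule that)
    then have \<tau>: "\<tau> 0 = 0" "strict_mono_on {0..n} \<tau>" and idx: "\<And>j. j \<in> J \<Longrightarrow> idx j \<le> n \<and> \<tau> (idx j) = j"
      by blast+
    have \<tau>m: "0 \<le> \<tau> i" "i \<noteq> 0 \<Longrightarrow> 0 \<le> \<tau> (i - 1) \<and> \<tau> (i - 1) \<le> \<tau> i" if "i \<le> n" for i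
      using that \<tau>(1) strict_mono_on_leD[OF \<tau>(2), of 0 i] strict_mono_on_leD[OF \<tau>(2), of 0 "i - 1"]
        strict_mono_on_leD[OF \<tau>(2), of "i - 1" i] by auto
    define \<Phi> where "\<Phi> v = (\<lambda>j\<in>J. \<Sum>i\<le>idx j. v i)" for v :: "nat \<Rightarrow> real"
    have \<Phi>: "\<Phi> \<in> measurable (\<Pi>\<^sub>M i\<in>{0..n}. borel) (\<Pi>\<^sub>M j\<in>J. borel)"
      unfolding \<Phi>_def[abs_def]
    proof (rule measurable_restrict)
      fix j assume "j \<in> J"
      then have "idx j \<le> n" using idx by blast
      then have "(\<lambda>v. v i) \<in> borel_measurable (\<Pi>\<^sub>M i\<in>{0..n}. (borel :: real measure))" if "i \<in> {..idx j}" for i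
        by (intro measurable_component_singleton) (use that in simp)
      then show "(\<lambda>v. \<Sum>i\<le>idx j. v i :: real) \<in> borel_measurable (\<Pi>\<^sub>M i\<in>{0..n}. borel)"
        by (rule borel_measurable_sum)
    qed
    have marg: "distr M (\<Pi>\<^sub>M \<tau>\<in>J. borel) (\<lambda>\<omega>. \<lambda>\<tau>\<in>J. X \<tau> \<omega>) =
      distr (\<Pi>\<^sub>M i\<in>{0..n}. distr M borel (\<lambda>\<omega>. if i = 0 then X 0 \<omega> else X (\<tau> i) \<omega> - X (\<tau> (i - 1)) \<omega>)) (\<Pi>\<^sub>M \<tau>\<in>J. borel) \<Phi>"
      if "subordinator M X" for M :: "'z measure" and X
    proof -
      interpret subordinator M X by fact
      let ?D = "\<lambda>i \<omega>. if i = 0 then X 0 \<omega> else X (\<tau> i) \<omega> - X (\<tau> (i - 1)) \<omega>"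
      have Dm: "?D i \<in> borel_measurable M" if "i \<in> {0..n}" for i
        using that \<tau>m[of i] measurable_X[of 0] measurable_increment[of "\<tau> (i - 1)" "\<tau> i"] by (cases "i = 0") auto
      have sum: "(\<Sum>i\<le>m. ?D i \<omega>) = X (\<tau> m) \<omega>" for m \<omega>
        by (induction m) (auto simp: \<tau>(1))
      have "(\<lambda>\<omega>. \<lambda>\<tau>\<in>J. X \<tau> \<omega>) = \<Phi> \<circ> (\<lambda>\<omega>. \<lambda>i\<in>{0..n}. ?D i \<omega>)"
      proof (rule ext)
        fix \<omega>
        have "X j \<omega> = (\<Sum>i\<le>idx j. (\<lambda>i\<in>{0..n}. ?D i \<omega>) i)" if "j \<in> J" for j
        proof -
          have "(\<Sum>i\<le>idx j. (\<lambda>i\<in>{0..n}. ?D i \<omega>) i) = (\<Sum>i\<le>idx j. ?D i \<omega>)"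
            using idx[OF that] by (intro sum.cong refl) (simp add: restrict_def)
          then show ?thesis using idx[OF that] by (simp only: sum)
        qed
        then show "(\<lambda>\<tau>\<in>J. X \<tau> \<omega>) = (\<Phi> \<circ> (\<lambda>\<omega>. \<lambda>i\<in>{0..n}. ?D i \<omega>)) \<omega>"
          unfolding \<Phi>_def comp_def by (intro restrict_ext) blast
      qed
      then have "distr M (\<Pi>\<^sub>M \<tau>\<in>J. borel) (\<lambda>\<omega>. \<lambda>\<tau>\<in>J. X \<tau> \<omega>) =
          distr (distr M (\<Pi>\<^sub>M i\<in>{0..n}. borel) (\<lambda>\<omega>. \<lambda>i\<in>{0..n}. ?D i \<omega>)) (\<Pi>\<^sub>M \<tau>\<in>J. borel) \<Phi>"
        using distr_distr[OF \<Phi> measurable_restrict[OF Dm]] by simp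
      also have "distr M (\<Pi>\<^sub>M i\<in>{0..n}. borel) (\<lambda>\<omega>. \<lambda>i\<in>{0..n}. ?D i \<omega>) =
          (\<Pi>\<^sub>M i\<in>{0..n}. distr M borel (?D i))"
        using independent_increments[OF \<tau>]
        by (subst indep_vars_iff_distr_eq_PiM'[symmetric]) (use Dm in auto)
      finally show ?thesis .
    qed
    have "distr M borel (\<lambda>\<omega>. if i = 0 then X 0 \<omega> else X (\<tau> i) \<omega> - X (\<tau> (i - 1)) \<omega>) =
        distr N borel (\<lambda>\<omega>. if i = 0 then Y 0 \<omega> else Y (\<tau> i) \<omega> - Y (\<tau> (i - 1)) \<omega>)"
      if i: "i \<in> {0..n}" for i
    proof (cases "i = 0")
      case True
      have "distr M borel (X 0) = distr M borel (\<lambda>_. c)"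
        using X0 M.measurable_X[of 0] by (intro distr_cong_AE) auto
      moreover have "distr N borel (Y 0) = distr N borel (\<lambda>_. c)"
        using Y0 N.measurable_X[of 0] by (intro distr_cong_AE) auto
      ultimately show ?thesis using True by (simp add: M.distr_const N.distr_const)
    next
      case False
      with i \<tau>m[of i] have "0 \<le> \<tau> (i - 1)" "\<tau> (i - 1) \<le> \<tau> i" by auto
      then have "distr M borel (\<lambda>\<omega>. X (\<tau> i) \<omega> - X (\<tau> (i - 1)) \<omega>) = distr N borel (\<lambda>\<omega>. Y (\<tau> i) \<omega> - Y (\<tau> (i - 1)) \<omega>)"
        by (intro distr_eqI_Laplace lap M.prob_space_axioms N.prob_space_axioms
            M.measurable_increment N.measurable_increment AE_I2 M.increment_nonneg N.increment_nonneg)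
      then show ?thesis using False by simp
    qed
    then show "distr M (\<Pi>\<^sub>M \<tau>\<in>J. borel) (\<lambda>\<omega>. \<lambda>\<tau>\<in>J. X \<tau> \<omega>) = distr N (\<Pi>\<^sub>M \<tau>\<in>J. borel) (\<lambda>\<omega>. \<lambda>\<tau>\<in>J. Y \<tau> \<omega>)"
      unfolding marg[OF subM] marg[OF subN]
      by (intro arg_cong[where f="\<lambda>P. distr P (\<Pi>\<^sub>M \<tau>\<in>J. borel) \<Phi>"] PiM_cong refl)
  qed
qed

section \<open>Poisson point processes\<close>

lemma integral_PiM_prod:
  fixes P :: "'i \<Rightarrow> 'a measure" and g :: "'i \<Rightarrow> 'a \<Rightarrow> real"
  assumes P: "\<And>i. prob_space (P i)" and J: "finite J"
    and g: "\<And>i. i \<in> J \<Longrightarrow> integrable (P i) (g i)"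
  shows "(LINT \<omega>|Pi\<^sub>M UNIV P. (\<Prod>i\<in>J. g i (\<omega> i))) = (\<Prod>i\<in>J. LINT x|P i. g i x)"
proof -
  interpret P: prob_space "P i" for i by (rule P)
  interpret product_sigma_finite P by standard
  have r: "(\<lambda>\<omega>. \<lambda>n\<in>J. \<omega> n) \<in> measurable (Pi\<^sub>M UNIV P) (Pi\<^sub>M J P)"
    by (rule measurable_restrict) auto
  have gm [measurable]: "g i \<in> borel_measurable (P i)" if "i \<in> J" for i using g[OF that] by auto
  have "(LINT \<omega>|Pi\<^sub>M UNIV P. (\<Prod>i\<in>J. g i (\<omega> i))) =
      (LINT \<omega>|Pi\<^sub>M UNIV P. (\<Prod>i\<in>J. g i ((\<lambda>n\<in>J. \<omega> n) i)))"
    by (intro Bochner_Integration.integral_cong prod.cong) auto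
  also have "\<dots> = (LINT \<omega>|distr (Pi\<^sub>M UNIV P) (Pi\<^sub>M J P) (\<lambda>\<omega>. \<lambda>n\<in>J. \<omega> n). (\<Prod>i\<in>J. g i (\<omega> i)))"
    by (rule integral_distr[symmetric, OF r]) measurable
  also have "distr (Pi\<^sub>M UNIV P) (Pi\<^sub>M J P) (\<lambda>\<omega>. \<lambda>n\<in>J. \<omega> n) = Pi\<^sub>M J P"
    using distr_PiM_reindex[of UNIV P "\<lambda>x. x" J] P by auto
  also have "(LINT \<omega>|Pi\<^sub>M J P. (\<Prod>i\<in>J. g i (\<omega> i))) = (\<Prod>i\<in>J. LINT x|P i. g i x)"
    by (rule product_integral_prod[OF J g])
  finally show ?thesis .
qed

text \<open>Rate \<open>0\<close> is included so that null pieces of an intensity measure need no separate treatment.\<close>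
lemma exists_poisson_pmf:
  assumes "0 \<le> (c::real)"
  obtains q where "\<And>k. pmf q k = c ^ k / fact k * exp (- c)"
proof (cases "c = 0")
  case True
  show ?thesis by (rule that[of "return_pmf 0"]) (auto simp: True indicator_def)
next
  case False
  then show ?thesis using assms by (intro that[of "poisson_pmf c"]) simp
qed

lemma integral_power_poisson:
  assumes "0 \<le> (c::real)" and q: "\<And>k. pmf q k = c ^ k / fact k * exp (- c)" and a: "0 \<le> a" "a \<le> 1"
  shows "(LINT n|measure_pmf q. a ^ n) = exp (- (c * (1 - a)))"
proof -
  have s: "(\<lambda>k. pmf q k * a ^ k) sums (exp (- c) * exp (c * a))"
    using sums_mult[OF exp_converges[of "c * a"], of "exp (- c)"]
    by (simp add: q field_simps power_mult_distrib)
  have "(LINT n|measure_pmf q. a ^ n) = (LINT n|count_space UNIV. pmf q n * a ^ n)"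
    unfolding measure_pmf_eq_density by (subst integral_density) (auto simp: AE_count_space)
  also have "\<dots> = exp (- c) * exp (c * a)"
  proof (rule sums_unique2[OF _ s])
    have "integrable (count_space UNIV) (\<lambda>n. pmf q n * a ^ n)"
      using s a by (simp add: integrable_count_space_nat_iff summable_def abs_mult) blast
    then show "(\<lambda>n. pmf q n * a ^ n) sums (LINT n|count_space UNIV. pmf q n * a ^ n)"
      by (rule sums_integral_count_space_nat)
  qed
  also have "\<dots> = exp (- (c * (1 - a)))"
    by (simp add: exp_add[symmetric] algebra_simps)
  finally show ?thesis .
qed

text \<open>A sample \<open>(n, z)\<close> stands for the cloud of the points \<open>z 0, \<dots>, z (n - 1)\<close>: their number is Poisson
distributed with parameter the total mass \<open>c\<close> of the intensity, and the \<open>z i\<close> are independent with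
law \<open>\<mu> / c\<close>. Conditioning on the number reduces the formula to the generating function of the
Poisson distribution.\<close>
lemma exists_finite_poisson_process:
  fixes \<mu> :: "'a measure"
  assumes "finite_measure \<mu>" "space \<mu> \<noteq> {}"
  shows "\<exists>Q :: (nat \<times> (nat \<Rightarrow> 'a)) measure. prob_space Q \<and> fst \<in> measurable Q (count_space UNIV) \<and>
    (\<forall>i. (\<lambda>\<omega>. snd \<omega> i) \<in> measurable Q \<mu>) \<and>
    (\<forall>g\<in>borel_measurable \<mu>. (\<forall>x\<in>space \<mu>. 0 \<le> g x \<and> g x \<le> (1::real)) \<longrightarrow>
       (LINT \<omega>|Q. (\<Prod>i<fst \<omega>. g (snd \<omega> i))) = exp (- (LINT x|\<mu>. 1 - g x)))"
proof -
  interpret \<mu>: finite_measure \<mu> by fact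
  obtain x0 where x0: "x0 \<in> space \<mu>" using assms by auto
  define c where "c = measure \<mu> (space \<mu>)"
  have c0: "0 \<le> c" by (simp add: c_def)
  \<comment> \<open>for \<open>c = 0\<close> the cloud is empty and any law of the points will do\<close>
  define P where "P = (if c = 0 then return \<mu> x0 else density \<mu> (\<lambda>_. ennreal (1 / c)))"
  have sP [measurable_cong]: "sets P = sets \<mu>" by (simp add: P_def)
  have "prob_space P"
  proof (cases "c = 0")
    case True
    then show ?thesis by (simp add: P_def prob_space_return x0)
  next
    case False
    have "emeasure (density \<mu> (\<lambda>_. ennreal (1 / c))) (space \<mu>) = (\<integral>\<^sup>+x. ennreal (1 / c) * indicator (space \<mu>) x \<partial>\<mu>)"
      by (rule emeasure_density) auto
    also have "\<dots> = ennreal (1 / c) * emeasure \<mu> (space \<mu>)"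
      by (rule nn_integral_cmult_indicator) simp
    also have "\<dots> = 1" using False c0
      by (simp add: \<mu>.emeasure_eq_measure c_def[symmetric] ennreal_mult[symmetric])
    finally show ?thesis using False by (intro prob_spaceI) (simp add: P_def)
  qed
  interpret P: prob_space P by fact
  have intP: "c * (LINT x|P. g x) = (LINT x|\<mu>. g x)"
    if [measurable]: "g \<in> borel_measurable \<mu>" for g :: "'a \<Rightarrow> real"
  proof (cases "c = 0")
    case True
    then have "emeasure \<mu> (space \<mu>) = 0" by (simp add: \<mu>.emeasure_eq_measure c_def)
    then have "AE x in \<mu>. g x = 0" by (auto intro!: AE_I[of _ _ "space \<mu>"])
    then show ?thesis using True integral_eq_zero_AE by auto
  next
    case False
    then show ?thesis using c0 by (simp add: P_def integral_density)
  qed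
  obtain q where q: "\<And>k. pmf q k = c ^ k / fact k * exp (- c)"
    by (rule exists_poisson_pmf[OF c0]) blast
  define R where "R = (\<Pi>\<^sub>M i\<in>(UNIV::nat set). P)"
  interpret R: prob_space R unfolding R_def by (rule prob_space_PiM) (rule P.prob_space_axioms)
  define Q where "Q = measure_pmf q \<Otimes>\<^sub>M R"
  interpret QR: pair_prob_space "measure_pmf q" R ..
  have N: "fst \<in> measurable Q (count_space UNIV)"
    unfolding Q_def by (rule measurable_compose[OF measurable_fst]) simp
  have Zi: "(\<lambda>\<omega>. \<omega> i) \<in> measurable R \<mu>" for i
    using measurable_component_singleton[of i UNIV "\<lambda>_. P"] measurable_cong_sets[OF refl sP]
    by (auto simp: R_def)
  have Z: "(\<lambda>\<omega>. snd \<omega> i) \<in> measurable Q \<mu>" for i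
    unfolding Q_def by (rule measurable_compose[OF measurable_snd Zi])
  have "(LINT \<omega>|Q. (\<Prod>i<fst \<omega>. g (snd \<omega> i))) = exp (- (LINT x|\<mu>. 1 - g x))"
    if g [measurable]: "g \<in> borel_measurable \<mu>" and g01: "\<And>x. x \<in> space \<mu> \<Longrightarrow> 0 \<le> g x \<and> g x \<le> (1::real)" for g
  proof -
    have gP: "integrable P g"
      using g01 sets_eq_imp_space_eq[OF sP]
      by (intro P.integrable_const_bound[where B=1]) auto
    have gm: "integrable \<mu> g"
      using g01 by (intro \<mu>.integrable_const_bound[where B=1]) auto
    have m: "(\<lambda>\<omega>. \<Prod>i<fst \<omega>. g (snd \<omega> i)) \<in> borel_measurable Q"
      by (rule measurable_compose_countable[OF _ N, of "\<lambda>n \<omega>. \<Prod>i<n. g (snd \<omega> i)"])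
        (intro borel_measurable_prod measurable_compose[OF Z g])
    have spQ: "snd \<omega> i \<in> space \<mu>" if "\<omega> \<in> space Q" for \<omega> i
      using measurable_space[OF Z that] .
    have "integrable Q (\<lambda>\<omega>. \<Prod>i<fst \<omega>. g (snd \<omega> i))"
      unfolding Q_def
    proof (rule QR.integrable_const_bound[where B=1])
      show "AE \<omega> in measure_pmf q \<Otimes>\<^sub>M R. norm (\<Prod>i<fst \<omega>. g (snd \<omega> i)) \<le> 1"
        using spQ g01 unfolding Q_def
        by (intro AE_I2) (auto simp: abs_prod intro!: prod_le_1)
    qed (use m in \<open>simp add: Q_def\<close>)
    then have "(LINT \<omega>|Q. (\<Prod>i<fst \<omega>. g (snd \<omega> i))) = (LINT n|measure_pmf q. LINT \<omega>|R. (\<Prod>i<n. g (\<omega> i)))"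
      unfolding Q_def by (subst QR.integral_fst'[symmetric]) simp_all
    also have "\<dots> = (LINT n|measure_pmf q. (LINT x|P. g x) ^ n)"
      unfolding R_def using P.prob_space_axioms gP by (subst integral_PiM_prod) auto
    also have "\<dots> = exp (- (c * (1 - (LINT x|P. g x))))"
    proof (rule integral_power_poisson[OF c0 q])
      show "0 \<le> (LINT x|P. g x)"
        using g01 sets_eq_imp_space_eq[OF sP] by (intro integral_nonneg_AE AE_I2) auto
      have "(LINT x|P. g x) \<le> (LINT x|P. 1)"
        using g01 sets_eq_imp_space_eq[OF sP] gP by (intro integral_mono) auto
      then show "(LINT x|P. g x) \<le> 1" by (simp add: P.prob_space)
    qed
    also have "c * (1 - (LINT x|P. g x)) = (LINT x|\<mu>. 1 - g x)"
    proof -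
      have "(LINT x|\<mu>. 1 - g x) = c - (LINT x|\<mu>. g x)" using gm by (simp add: c_def)
      then show ?thesis by (simp add: right_diff_distrib intP[OF g])
    qed
    finally show ?thesis .
  qed
  moreover have "prob_space Q" unfolding Q_def by unfold_locales
  ultimately show ?thesis using N Z by (intro exI[of _ Q]) auto
qed

lemma pred_summable:
  fixes H :: "nat \<Rightarrow> 'a \<Rightarrow> real"
  assumes [measurable]: "\<And>k. H k \<in> borel_measurable M"
  shows "Measurable.pred M (\<lambda>\<omega>. summable (\<lambda>k. H k \<omega>))"
proof -
  have *: "summable (\<lambda>k. H k \<omega>) \<longleftrightarrow> Cauchy (\<lambda>n. \<Sum>k<n. H k \<omega>)" for \<omega>
    by (simp add: summable_iff_convergent Cauchy_convergent_iff)
  show ?thesis unfolding * pred_def by (rule sets_Collect_Cauchy) measurable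
qed

text \<open>Partial sums of a divergent series of nonnegative terms tend to infinity, which makes their
exponentials vanish in the limit; letting \<open>\<theta>\<close> tend to \<open>0\<close> afterwards will measure the event of
convergence.\<close>
lemma (in prob_space) limit_Laplace_partial_sums:
  fixes H :: "nat \<Rightarrow> 'a \<Rightarrow> real"
  assumes H [measurable]: "\<And>k. H k \<in> borel_measurable M"
    and nonneg: "\<And>k \<omega>. \<omega> \<in> space M \<Longrightarrow> 0 \<le> H k \<omega>" and \<theta>: "0 < \<theta>"
  shows "(\<lambda>n. LINT \<omega>|M. exp (- \<theta> * (\<Sum>k<n. H k \<omega>))) \<longlonglongrightarrow>
    (LINT \<omega>|M. (if summable (\<lambda>k. H k \<omega>) then exp (- \<theta> * (\<Sum>k. H k \<omega>)) else 0))"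
    and "{\<omega>\<in>space M. summable (\<lambda>k. H k \<omega>)} \<in> sets M"
proof -
  note pred_summable[OF H, measurable]
  show "{\<omega>\<in>space M. summable (\<lambda>k. H k \<omega>)} \<in> sets M" by measurable
  show "(\<lambda>n. LINT \<omega>|M. exp (- \<theta> * (\<Sum>k<n. H k \<omega>))) \<longlonglongrightarrow>
    (LINT \<omega>|M. (if summable (\<lambda>k. H k \<omega>) then exp (- \<theta> * (\<Sum>k. H k \<omega>)) else 0))"
  proof (rule integral_dominated_convergence[where w="\<lambda>_. 1"])
    show "AE \<omega> in M. (\<lambda>n. exp (- \<theta> * (\<Sum>k<n. H k \<omega>))) \<longlonglongrightarrow>
        (if summable (\<lambda>k. H k \<omega>) then exp (- \<theta> * (\<Sum>k. H k \<omega>)) else 0)"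
    proof (rule AE_I2)
      fix \<omega> assume \<omega>: "\<omega> \<in> space M"
      show "(\<lambda>n. exp (- \<theta> * (\<Sum>k<n. H k \<omega>))) \<longlonglongrightarrow>
        (if summable (\<lambda>k. H k \<omega>) then exp (- \<theta> * (\<Sum>k. H k \<omega>)) else 0)"
      proof (cases "summable (\<lambda>k. H k \<omega>)")
        case True
        then show ?thesis by (auto intro!: tendsto_intros summable_LIMSEQ)
      next
        case False
        have inc: "mono (\<lambda>n. \<Sum>k<n. H k \<omega>)"
          using nonneg[OF \<omega>] by (auto intro!: sum_mono2 monoI)
        have "filterlim (\<lambda>n. \<Sum>k<n. H k \<omega>) at_top sequentially"
        proof (rule filterlim_at_top[THEN iffD2], rule allI)
          fix Z
          have "\<exists>n. Z \<le> (\<Sum>k<n. H k \<omega>)"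
          proof (rule ccontr)
            assume "\<not> ?thesis"
            then have "summable (\<lambda>k. H k \<omega>)"
              using nonneg[OF \<omega>] by (intro summableI_nonneg_bounded[of _ Z]) (auto simp: not_le less_imp_le)
            then show False using False by simp
          qed
          then obtain n where "Z \<le> (\<Sum>k<n. H k \<omega>)" ..
          then show "\<forall>\<^sub>F n in sequentially. Z \<le> (\<Sum>k<n. H k \<omega>)"
            using monoD[OF inc] by (intro eventually_sequentiallyI[of n]) (auto intro: order_trans)
        qed
        then have "filterlim (\<lambda>n. - \<theta> * (\<Sum>k<n. H k \<omega>)) at_bot sequentially"
          using \<theta> by (intro filterlim_tendsto_neg_mult_at_bot[OF tendsto_const]) auto
        then show ?thesis using False by (auto intro: filterlim_compose[OF exp_at_bot])
      qed
    qed
    show "AE \<omega> in M. norm (exp (- \<theta> * (\<Sum>k<n. H k \<omega>))) \<le> 1" for n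
      using nonneg \<theta> by (intro AE_I2) (auto simp: sum_nonneg)
  qed measurable
qed

text \<open>The space is cut into countably many pieces of finite intensity, which carry independent finite
clouds \<open>Z k i\<close>, \<open>i < N k\<close>. The transform of the sum of \<open>h\<close> over the first \<open>n\<close> pieces is then a
product that converges. Almost sure summability is read off from the same formula:
\<open>exp (- \<integral> (1 - exp (- \<theta> h)))\<close> is a lower bound for the probability of summability and tends to \<open>1\<close>
as \<open>\<theta>\<close> tends to \<open>0\<close>.\<close>
lemma exists_poisson_process:
  fixes m :: "'a measure"
  assumes "sigma_finite_measure m" and ne: "space m \<noteq> {}"
  obtains Q :: "(nat \<Rightarrow> nat \<times> (nat \<Rightarrow> 'a)) measure"
    and N :: "nat \<Rightarrow> (nat \<Rightarrow> nat \<times> (nat \<Rightarrow> 'a)) \<Rightarrow> nat"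
    and Z :: "nat \<Rightarrow> nat \<Rightarrow> (nat \<Rightarrow> nat \<times> (nat \<Rightarrow> 'a)) \<Rightarrow> 'a"
  where "prob_space Q" "\<And>k. N k \<in> measurable Q (count_space UNIV)" "\<And>k i. Z k i \<in> measurable Q m"
    "\<And>h :: 'a \<Rightarrow> real. h \<in> borel_measurable m \<Longrightarrow> (\<And>x. x \<in> space m \<Longrightarrow> 0 \<le> h x) \<Longrightarrow>
       integrable m (\<lambda>x. 1 - exp (- h x)) \<Longrightarrow>
       (AE \<omega> in Q. summable (\<lambda>k. \<Sum>i<N k \<omega>. h (Z k i \<omega>))) \<and>
       (LINT \<omega>|Q. exp (- (\<Sum>k. \<Sum>i<N k \<omega>. h (Z k i \<omega>)))) = exp (- (LINT x|m. 1 - exp (- h x)))"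
proof -
  interpret m: sigma_finite_measure m by fact
  obtain A :: "nat \<Rightarrow> 'a set" where A: "range A \<subseteq> sets m" "(\<Union>i. A i) = space m"
      "\<And>i. emeasure m (A i) \<noteq> \<infinity>" "disjoint_family A"
    by (rule m.sigma_finite_disjoint) blast
  have [measurable]: "A k \<in> sets m" for k using A(1) by auto
  define \<mu> where "\<mu> k = density m (indicator (A k))" for k
  have s\<mu> [measurable_cong]: "sets (\<mu> k) = sets m" for k by (simp add: \<mu>_def)
  have sp\<mu>: "space (\<mu> k) = space m" for k by (simp add: \<mu>_def)
  have fin: "finite_measure (\<mu> k)" for k
    using A(3)[of k] by (intro finite_measureI) (simp add: \<mu>_def emeasure_density nn_integral_indicator cong: nn_integral_cong_simp)
  let ?P = "\<lambda>k (Q :: (nat \<times> (nat \<Rightarrow> 'a)) measure). prob_space Q \<and> fst \<in> measurable Q (count_space UNIV) \<and>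
    (\<forall>i. (\<lambda>\<omega>. snd \<omega> i) \<in> measurable Q (\<mu> k)) \<and>
    (\<forall>g\<in>borel_measurable (\<mu> k). (\<forall>x\<in>space (\<mu> k). 0 \<le> g x \<and> g x \<le> (1::real)) \<longrightarrow>
       (LINT \<omega>|Q. (\<Prod>i<fst \<omega>. g (snd \<omega> i))) = exp (- (LINT x|\<mu> k. 1 - g x)))"
  have "\<forall>k. \<exists>Q. ?P k Q"
  proof
    fix k
    have "space (\<mu> k) \<noteq> {}" using ne by (simp add: sp\<mu>)
    then show "\<exists>Q. ?P k Q" by (rule exists_finite_poisson_process[OF fin])
  qed
  then have "\<exists>Q. \<forall>k. ?P k (Q k)" by (rule choice)
  then obtain Q where PQ: "\<And>k. ?P k (Q k)" by blast
  have Q: "prob_space (Q k)" "fst \<in> measurable (Q k) (count_space UNIV)" for k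
    using PQ[of k] by blast+
  have QZ: "(\<lambda>\<omega>. snd \<omega> i) \<in> measurable (Q k) (\<mu> k)" for k i
    using PQ[of k] by blast
  have Qg: "(LINT \<omega>|Q k. (\<Prod>i<fst \<omega>. g (snd \<omega> i))) = exp (- (LINT x|\<mu> k. 1 - g x))"
    if "g \<in> borel_measurable (\<mu> k)" "\<And>x. x \<in> space (\<mu> k) \<Longrightarrow> 0 \<le> g x \<and> g x \<le> (1::real)" for k g
    using PQ[of k] that by blast
  define R where "R = Pi\<^sub>M UNIV Q"
  define N where "N k \<omega> = fst (\<omega> k)" for k and \<omega> :: "nat \<Rightarrow> nat \<times> (nat \<Rightarrow> 'a)"
  define Z where "Z k i \<omega> = snd (\<omega> k) i" for k i and \<omega> :: "nat \<Rightarrow> nat \<times> (nat \<Rightarrow> 'a)"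
  interpret R: prob_space R unfolding R_def by (rule prob_space_PiM) (rule Q)
  have comp: "(\<lambda>\<omega>. \<omega> k) \<in> measurable R (Q k)" for k
    unfolding R_def by (rule measurable_component_singleton) simp
  have N: "N k \<in> measurable R (count_space UNIV)" for k
    unfolding N_def[abs_def] by (rule measurable_compose[OF comp Q(2)])
  have QZm: "(\<lambda>\<omega>. snd \<omega> i) \<in> measurable (Q k) m" for k i
    using QZ[of i k] measurable_cong_sets[OF refl s\<mu>] by blast
  have Z: "Z k i \<in> measurable R m" for k i
    unfolding Z_def[abs_def] by (rule measurable_compose[OF comp QZm])
  have main: "(AE \<omega> in R. summable (\<lambda>k. \<Sum>i<N k \<omega>. h (Z k i \<omega>))) \<and>
       (LINT \<omega>|R. exp (- (\<Sum>k. \<Sum>i<N k \<omega>. h (Z k i \<omega>)))) = exp (- (LINT x|m. 1 - exp (- h x)))"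
    if h [measurable]: "h \<in> borel_measurable m" and h0: "\<And>x. x \<in> space m \<Longrightarrow> 0 \<le> h x"
      and hi: "integrable m (\<lambda>x. 1 - exp (- h x))" for h :: "'a \<Rightarrow> real"
  proof -
    define H where "H k \<omega> = (\<Sum>i<N k \<omega>. h (Z k i \<omega>))" for k \<omega>
    have Hm [measurable]: "H k \<in> borel_measurable R" for k
      unfolding H_def[abs_def]
      by (rule measurable_compose_countable[OF _ N, of "\<lambda>n \<omega>. \<Sum>i<n. h (Z k i \<omega>)"])
        (intro borel_measurable_sum measurable_compose[OF Z h])
    have H0: "0 \<le> H k \<omega>" if "\<omega> \<in> space R" for k \<omega>
      unfolding H_def using measurable_space[OF Z that] by (auto intro!: sum_nonneg h0)
    have lim: "(\<lambda>n. LINT \<omega>|R. exp (- \<theta> * (\<Sum>k<n. H k \<omega>))) \<longlonglongrightarrow> exp (- (LINT x|m. 1 - exp (- \<theta> * h x)))"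
      if \<theta>: "0 < \<theta>" "\<theta> \<le> 1" for \<theta>
    proof -
      define f where "f x = 1 - exp (- \<theta> * h x)" for x
      have fm [measurable]: "f \<in> borel_measurable m" unfolding f_def[abs_def] by measurable
      have f01: "0 \<le> f x" "f x \<le> 1 - exp (- h x)" if "x \<in> space m" for x
        using h0[OF that] \<theta> mult_right_mono[OF \<theta>(2) h0[OF that]] by (auto simp: f_def)
      have fi: "integrable m f"
        using hi by (rule Bochner_Integration.integrable_bound) (use f01 in \<open>auto intro!: AE_I2 intro: order_trans[OF _ abs_ge_self]\<close>)
      have fAi: "integrable m (\<lambda>x. indicator (A k) x * f x)" for k
        using integrable_mult_indicator[OF _ fi, of "A k"] by simp
      have partial: "(LINT \<omega>|R. exp (- \<theta> * (\<Sum>k<n. H k \<omega>))) = exp (- (\<Sum>k<n. LINT x|m. indicator (A k) x * f x))" for n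
      proof -
        define g where "g x = exp (- \<theta> * h x)" for x
        have gm [measurable]: "g \<in> borel_measurable m" unfolding g_def[abs_def] by measurable
        have g01: "0 \<le> g x \<and> g x \<le> 1" if "x \<in> space m" for x
          using h0[OF that] \<theta> by (auto simp: g_def)
        have "exp (- \<theta> * (\<Sum>k<n. H k \<omega>)) = (\<Prod>k<n. \<Prod>i<fst (\<omega> k). g (snd (\<omega> k) i))" for \<omega>
          by (simp add: H_def N_def Z_def g_def exp_sum[symmetric] sum_distrib_left sum_negf[symmetric])
        then have "(LINT \<omega>|R. exp (- \<theta> * (\<Sum>k<n. H k \<omega>))) =
            (LINT \<omega>|R. (\<Prod>k<n. (\<lambda>\<omega>. \<Prod>i<fst \<omega>. g (snd \<omega> i)) (\<omega> k)))" by simp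
        also have "\<dots> = (\<Prod>k<n. LINT \<omega>|Q k. (\<Prod>i<fst \<omega>. g (snd \<omega> i)))"
          unfolding R_def
        proof (rule integral_PiM_prod[OF Q(1)])
          fix k
          interpret Qk: prob_space "Q k" by (rule Q)
          have "(\<lambda>\<omega>. \<Prod>i<fst \<omega>. g (snd \<omega> i)) \<in> borel_measurable (Q k)"
            by (rule measurable_compose_countable[OF _ Q(2), of "\<lambda>n \<omega>. \<Prod>i<n. g (snd \<omega> i)"])
              (intro borel_measurable_prod measurable_compose[OF QZm gm])
          moreover have "AE \<omega> in Q k. norm (\<Prod>i<fst \<omega>. g (snd \<omega> i)) \<le> 1"
            using measurable_space[OF QZm] g01 by (intro AE_I2) (auto simp: abs_prod intro!: prod_le_1)
          ultimately show "integrable (Q k) (\<lambda>\<omega>. \<Prod>i<fst \<omega>. g (snd \<omega> i))"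
            by (intro Qk.integrable_const_bound[where B=1]) auto
        qed simp
        also have "\<dots> = (\<Prod>k<n. exp (- (LINT x|\<mu> k. 1 - g x)))"
          using g01 by (intro prod.cong refl Qg) (auto simp: sp\<mu>)
        also have "\<dots> = (\<Prod>k<n. exp (- (LINT x|m. indicator (A k) x * f x)))"
        proof (intro prod.cong refl arg_cong[where f="\<lambda>r. exp (- r)"])
          fix k
          have "(indicator (A k) :: _ \<Rightarrow> ennreal) = (\<lambda>x. ennreal (indicator (A k) x))"
            by (auto simp: indicator_def)
          then show "(LINT x|\<mu> k. 1 - g x) = (LINT x|m. indicator (A k) x * f x)"
            unfolding \<mu>_def by (simp add: integral_density f_def g_def)
        qed
        finally show ?thesis by (simp add: exp_sum[symmetric] sum_negf)
      qed
      have "(\<lambda>n. \<Sum>k<n. LINT x|m. indicator (A k) x * f x) \<longlonglongrightarrow> (LINT x|m. f x)"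
      proof -
        have "(\<lambda>n. LINT x|m. (\<Sum>k<n. indicator (A k) x * f x)) \<longlonglongrightarrow> (LINT x|m. f x)"
        proof (rule integral_dominated_convergence[where w="f"])
          have *: "(\<Sum>k<n. indicator (A k) x * f x) = indicator (\<Union>k<n. A k) x * f x" for n x
            using A(4) by (subst indicator_UN_disjoint) (auto simp: disjoint_family_on_def sum_distrib_right)
          show "AE x in m. (\<lambda>n. \<Sum>k<n. indicator (A k) x * f x) \<longlonglongrightarrow> f x"
          proof (rule AE_I2)
            fix x assume "x \<in> space m"
            then have "indicator (\<Union>i. A i) x = (1::real)" using A(2) by simp
            then show "(\<lambda>n. \<Sum>k<n. indicator (A k) x * f x) \<longlonglongrightarrow> f x"
              using tendsto_mult_right[OF LIMSEQ_indicator_UN[of A x], of "f x"] unfolding * by simp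
          qed
          show "AE x in m. norm (\<Sum>k<n. indicator (A k) x * f x) \<le> f x" for n
            unfolding * using f01 by (intro AE_I2) (auto simp: indicator_def)
        qed (use fi in auto)
        also have "(\<lambda>n. LINT x|m. (\<Sum>k<n. indicator (A k) x * f x)) =
            (\<lambda>n. \<Sum>k<n. LINT x|m. indicator (A k) x * f x)"
          using fAi by (intro ext Bochner_Integration.integral_sum)
        finally show ?thesis .
      qed
      then have "(\<lambda>n. exp (- (\<Sum>k<n. LINT x|m. indicator (A k) x * f x))) \<longlonglongrightarrow> exp (- (LINT x|m. f x))"
        by (intro tendsto_intros)
      then show ?thesis unfolding partial by (simp only: f_def)
    qed
    define G where "G \<theta> \<omega> = (if summable (\<lambda>k. H k \<omega>) then exp (- \<theta> * (\<Sum>k. H k \<omega>)) else 0)" for \<theta> \<omega>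
    have EG: "(LINT \<omega>|R. G \<theta> \<omega>) = exp (- (LINT x|m. 1 - exp (- \<theta> * h x)))" if "0 < \<theta>" "\<theta> \<le> 1" for \<theta>
      using LIMSEQ_unique[OF R.limit_Laplace_partial_sums(1)[OF Hm H0 that(1)] lim[OF that]]
      by (simp add: G_def[abs_def])
    define S where "S = {\<omega>\<in>space R. summable (\<lambda>k. H k \<omega>)}"
    have S [measurable]: "S \<in> sets R"
      unfolding S_def by (rule R.limit_Laplace_partial_sums(2)[OF Hm H0, of 1]) auto
    have "exp (- (LINT x|m. 1 - exp (- (1 / real (Suc j)) * h x))) \<le> R.prob S" for j
    proof -
      have "(LINT \<omega>|R. G (1 / real (Suc j)) \<omega>) \<le> (LINT \<omega>|R. indicator S \<omega>)"
      proof (rule integral_mono')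
        fix \<omega> assume \<omega>: "\<omega> \<in> space R"
        show "G (1 / real (Suc j)) \<omega> \<le> indicator S \<omega>"
          using \<omega> H0[OF \<omega>] by (auto simp: G_def S_def suminf_nonneg)
      qed (auto simp: S R.emeasure_eq_measure)
      then show ?thesis by (subst (asm) EG) (auto simp: S)
    qed
    moreover have "(\<lambda>j. exp (- (LINT x|m. 1 - exp (- (1 / real (Suc j)) * h x)))) \<longlonglongrightarrow> exp (- (LINT x|m. 0))"
    proof (intro tendsto_intros integral_dominated_convergence[where w="\<lambda>x. 1 - exp (- h x)"] hi)
      show "AE x in m. (\<lambda>j. 1 - exp (- (1 / real (Suc j)) * h x)) \<longlonglongrightarrow> 0"
      proof (rule AE_I2)
        fix x
        have "(\<lambda>j. 1 - exp (- (1 / real (Suc j)) * h x)) \<longlonglongrightarrow> 1 - exp (- 0 * h x)"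
          using LIMSEQ_inverse_real_of_nat by (intro tendsto_intros) (simp add: inverse_eq_divide)
        then show "(\<lambda>j. 1 - exp (- (1 / real (Suc j)) * h x)) \<longlonglongrightarrow> 0" by simp
      qed
      show "AE x in m. norm (1 - exp (- (1 / real (Suc j)) * h x)) \<le> 1 - exp (- h x)" for j
      proof (rule AE_I2)
        fix x assume "x \<in> space m"
        note h0[OF this]
        moreover have "1 / real (Suc j) * h x \<le> 1 * h x"
          using \<open>0 \<le> h x\<close> by (intro mult_right_mono) auto
        ultimately show "norm (1 - exp (- (1 / real (Suc j)) * h x)) \<le> 1 - exp (- h x)"
          by auto
      qed
    qed measurable
    ultimately have "1 \<le> R.prob S" by (intro LIMSEQ_le_const2[of _ 1]) auto
    then have "R.prob S = 1" using R.prob_le_1[of S] by linarith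
    then have "AE \<omega> in R. \<omega> \<in> S" by (simp only: R.prob_eq_1[OF S])
    then have ae: "AE \<omega> in R. summable (\<lambda>k. H k \<omega>)"
      by eventually_elim (simp add: S_def)
    moreover have "(LINT \<omega>|R. exp (- (\<Sum>k. H k \<omega>))) = (LINT \<omega>|R. G 1 \<omega>)"
    proof (rule integral_cong_AE)
      show "AE \<omega> in R. exp (- (\<Sum>k. H k \<omega>)) = G 1 \<omega>"
        using ae by eventually_elim (simp add: G_def)
      have [measurable]: "Measurable.pred R (\<lambda>\<omega>. summable (\<lambda>k. H k \<omega>))"
        using S by (simp add: pred_def S_def)
      show "G 1 \<in> borel_measurable R" unfolding G_def[abs_def] by measurable
    qed measurable
    ultimately show ?thesis using EG[of 1] by (simp add: H_def)
  qed
  show ?thesis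
    by (rule that[OF R.prob_space_axioms N Z main])
qed

section \<open>Subordinators with a given Levy measure\<close>

text \<open>This bound makes \<open>1 - exp (- t * x)\<close> integrable with respect to a Levy measure. Combined with the
bound below it compares \<open>1 - exp (- t * x)\<close> with \<open>1 - exp (- x)\<close>.\<close>
lemma one_minus_exp_le:
  assumes "0 \<le> (x::real)" "0 \<le> t"
  shows "1 - exp (- t * x) \<le> (1 + t) * (x / (1 + x))"
proof -
  have "(1 - exp (- t * x)) * (1 + x) \<le> (1 + t) * x"
  proof -
    have "1 - exp (- t * x) \<le> t * x" using exp_ge_add_one_self[of "- t * x"] by simp
    moreover have "(1 - exp (- t * x)) * x \<le> 1 * x" using assms by (intro mult_right_mono) auto
    ultimately show ?thesis by (simp add: algebra_simps)
  qed
  then show ?thesis using assms by (simp add: field_simps)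
qed

lemma le_one_minus_exp:
  assumes "0 \<le> (x::real)" shows "x / (1 + x) \<le> 1 - exp (- x)"
proof -
  have "exp (- x) \<le> 1 / (1 + x)"
    using assms exp_ge_add_one_self[of x] by (simp add: exp_minus field_simps)
  then show ?thesis using assms by (simp add: field_simps)
qed

text \<open>The integrability condition allows infinitely many jumps near \<open>0\<close> per unit of time, provided that
their sizes are summable.\<close>
locale levy_measure =
  fixes \<nu> :: "real measure"
  assumes sets_\<nu>: "sets \<nu> = sets (restrict_space borel {0<..})"
    and finite_\<nu>: "(\<integral>\<^sup>+x. ennreal (x / (1 + x)) \<partial>\<nu>) < \<infinity>"
begin

definition jump_exponent :: "real \<Rightarrow> real" where
  "jump_exponent t = (LINT x|\<nu>. 1 - exp (- t * x))"

lemma space_\<nu>: "space \<nu> = {0<..}"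
  using sets_eq_imp_space_eq[OF sets_\<nu>] by (simp add: space_restrict_space)

lemma id_measurable [measurable]: "(\<lambda>x. x) \<in> borel_measurable \<nu>"
  unfolding measurable_cong_sets[OF sets_\<nu> refl] by (rule measurable_restrict_space1) simp

lemma integrable_ratio: "integrable \<nu> (\<lambda>x. x / (1 + x))"
proof (rule integrableI_bounded)
  have "(\<integral>\<^sup>+x. ennreal (norm (x / (1 + x))) \<partial>\<nu>) = (\<integral>\<^sup>+x. ennreal (x / (1 + x)) \<partial>\<nu>)"
    by (intro nn_integral_cong) (simp add: space_\<nu>)
  then show "(\<integral>\<^sup>+x. ennreal (norm (x / (1 + x))) \<partial>\<nu>) < \<infinity>" using finite_\<nu> by simp
qed measurable

lemma integrable_one_minus_exp:
  assumes "0 \<le> t" shows "integrable \<nu> (\<lambda>x. 1 - exp (- t * x))"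
proof (rule Bochner_Integration.integrable_bound)
  show "integrable \<nu> (\<lambda>x. (1 + t) * (x / (1 + x)))" using integrable_ratio by (rule integrable_mult_right)
  show "AE x in \<nu>. norm (1 - exp (- t * x)) \<le> norm ((1 + t) * (x / (1 + x)))"
  proof (rule AE_I2)
    fix x assume "x \<in> space \<nu>"
    then have x: "0 < x" by (simp add: space_\<nu>)
    then have "norm (1 - exp (- t * x)) = 1 - exp (- t * x)" using assms by simp
    also have "\<dots> \<le> (1 + t) * (x / (1 + x))" using x assms by (intro one_minus_exp_le) auto
    also have "\<dots> \<le> norm \<dots>" by (simp only: real_norm_def abs_ge_self)
    finally show "norm (1 - exp (- t * x)) \<le> norm ((1 + t) * (x / (1 + x)))" .
  qed
qed measurable

lemma jump_exponent_0: "jump_exponent 0 = 0" by (simp add: jump_exponent_def)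

lemma jump_exponent_nonneg: "0 \<le> t \<Longrightarrow> 0 \<le> jump_exponent t"
  unfolding jump_exponent_def by (intro integral_nonneg_AE AE_I2) (simp add: space_\<nu>)

lemma jump_exponent_le:
  assumes "0 \<le> t" shows "jump_exponent t \<le> (1 + t) * (LINT x|\<nu>. x / (1 + x))"
proof -
  have "jump_exponent t \<le> (LINT x|\<nu>. (1 + t) * (x / (1 + x)))"
    unfolding jump_exponent_def using assms
    by (intro integral_mono integrable_one_minus_exp integrable_mult_right integrable_ratio one_minus_exp_le)
      (auto simp: space_\<nu>)
  also have "\<dots> = (1 + t) * (LINT x|\<nu>. x / (1 + x))" by (rule integral_mult_right_zero)
  finally show ?thesis .
qed

sublocale sigma_finite_measure \<nu>
proof
  define A where "A n = {x\<in>space \<nu>. 1 / real (Suc n) < x / (1 + x)}" for n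
  have A: "A n \<in> sets \<nu>" for n unfolding A_def by measurable
  have "emeasure \<nu> (A n) < \<infinity>" for n
  proof -
    have "emeasure \<nu> (A n) = (\<integral>\<^sup>+x. indicator (A n) x \<partial>\<nu>)" using A by simp
    also have "\<dots> \<le> (\<integral>\<^sup>+x. ennreal (real (Suc n) * (x / (1 + x))) \<partial>\<nu>)"
    proof (rule nn_integral_mono)
      fix x assume x: "x \<in> space \<nu>"
      show "indicator (A n) x \<le> ennreal (real (Suc n) * (x / (1 + x)))"
      proof (cases "x \<in> A n")
        case True
        then have "1 / real (Suc n) < x / (1 + x)" by (simp add: A_def)
        then have "1 \<le> real (Suc n) * (x / (1 + x))" by (simp only: divide_less_eq mult.commute) simp
        then show ?thesis using True by simp
      qed simp
    qed
    also have "\<dots> = ennreal (LINT x|\<nu>. real (Suc n) * (x / (1 + x)))"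
      using integrable_ratio by (intro nn_integral_eq_integral integrable_mult_right AE_I2) (auto simp: space_\<nu>)
    also have "\<dots> < \<infinity>" by simp
    finally show ?thesis .
  qed
  moreover have "(\<Union>n. A n) = space \<nu>"
  proof (intro equalityI subsetI)
    fix x assume x: "x \<in> space \<nu>"
    then have "0 < x / (1 + x)" by (simp add: space_\<nu>)
    then obtain n where "inverse (real (Suc n)) < x / (1 + x)" using reals_Archimedean by blast
    then show "x \<in> (\<Union>n. A n)" using x by (auto simp: A_def inverse_eq_divide)
  qed (auto simp: A_def)
  ultimately show "\<exists>B. countable B \<and> B \<subseteq> sets \<nu> \<and> \<Union> B = space \<nu> \<and> (\<forall>a\<in>B. emeasure \<nu> a \<noteq> \<infinity>)"
    using A by (intro exI[of _ "range A"]) (auto simp: less_top)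
qed

lemma integrable_indicator_Ioc: "integrable lborel (indicator {a<..b} :: real \<Rightarrow> real)"
  by (cases "a \<le> b") (auto intro!: integrable_real_indicator)

text \<open>The intensity integral for the function \<open>(s, x) \<mapsto> w s * x\<close>, whose sum over the cloud collects the jump
at time \<open>s\<close> with weight \<open>w s\<close>. The bounded support of \<open>w\<close> makes it finite.\<close>
lemma strip_integral:
  fixes w :: "real \<Rightarrow> real"
  assumes w [measurable]: "w \<in> borel_measurable borel"
    and w_bound: "\<And>s. 0 \<le> w s" "\<And>s. w s \<le> c" and w_supp: "\<And>s. s \<notin> {0<..T} \<Longrightarrow> w s = 0"
  shows "integrable (lborel \<Otimes>\<^sub>M \<nu>) (\<lambda>p. 1 - exp (- (w (fst p) * snd p)))"
    and "(LINT p|(lborel \<Otimes>\<^sub>M \<nu>). 1 - exp (- (w (fst p) * snd p))) = (LINT s|lborel. jump_exponent (w s))"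
proof -
  interpret P: pair_sigma_finite "lborel :: real measure" \<nu> ..
  have m: "(\<lambda>p. 1 - exp (- (w (fst p) * snd p))) \<in> borel_measurable (lborel \<Otimes>\<^sub>M \<nu>)"
  proof -
    have [measurable]: "snd \<in> borel_measurable (lborel \<Otimes>\<^sub>M \<nu>)"
      by (rule measurable_compose[OF measurable_snd id_measurable])
    show ?thesis by measurable
  qed
  have norm: "(LINT x|\<nu>. norm (1 - exp (- (w s * x)))) = jump_exponent (w s)" for s
    unfolding jump_exponent_def using w_bound(1)[of s]
    by (intro Bochner_Integration.integral_cong refl) (simp add: space_\<nu>)
  have jm: "(\<lambda>s. jump_exponent (w s)) \<in> borel_measurable lborel"
    using borel_measurable_lebesgue_integral[of "\<lambda>s x. 1 - exp (- (w s * x))" lborel] m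
    by (simp add: jump_exponent_def split_beta')
  show i: "integrable (lborel \<Otimes>\<^sub>M \<nu>) (\<lambda>p. 1 - exp (- (w (fst p) * snd p)))"
  proof (rule P.Fubini_integrable[OF m])
    show "AE s in lborel. integrable \<nu> (\<lambda>x. 1 - exp (- (w (fst (s, x)) * snd (s, x))))"
      using integrable_one_minus_exp[OF w_bound(1)] by simp
    let ?B = "(1 + c) * (LINT x|\<nu>. x / (1 + x))"
    have r0: "0 \<le> (LINT x|\<nu>. x / (1 + x))" by (intro integral_nonneg_AE AE_I2) (simp add: space_\<nu>)
    have "integrable lborel (\<lambda>s. jump_exponent (w s))"
    proof (rule Bochner_Integration.integrable_bound[OF _ jm])
      show "integrable lborel (\<lambda>s. indicator {0<..T} s * ?B)"
        by (intro integrable_mult_left integrable_indicator_Ioc)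
      show "AE s in lborel. norm (jump_exponent (w s)) \<le> norm (indicator {0<..T} s * ?B)"
      proof (rule AE_I2)
        fix s
        show "norm (jump_exponent (w s)) \<le> norm (indicator {0<..T} s * ?B)"
        proof (cases "s \<in> {0<..T}")
          case True
          have "jump_exponent (w s) \<le> (1 + w s) * (LINT x|\<nu>. x / (1 + x))" by (rule jump_exponent_le[OF w_bound(1)])
          also have "\<dots> \<le> ?B" using w_bound(2)[of s] r0 by (intro mult_right_mono) auto
          finally show ?thesis using True jump_exponent_nonneg[OF w_bound(1), of s] by simp
        qed (simp add: w_supp jump_exponent_0)
      qed
    qed
    then show "integrable lborel (\<lambda>s. LINT x|\<nu>. norm (1 - exp (- (w (fst (s, x)) * snd (s, x)))))"
      by (simp only: fst_conv snd_conv norm)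
  qed
  show "(LINT p|(lborel \<Otimes>\<^sub>M \<nu>). 1 - exp (- (w (fst p) * snd p))) = (LINT s|lborel. jump_exponent (w s))"
    using P.integral_fst'[OF i] by (simp add: jump_exponent_def)
qed

text \<open>At each time at most one of the disjoint intervals is active, so the nonlinear function
\<open>jump_exponent\<close> may be applied to each step separately. The additivity over disjoint intervals is
the source of the independence of increments.\<close>
lemma jump_exponent_step:
  assumes J: "finite J" and ab: "\<And>j. j \<in> J \<Longrightarrow> a j \<le> b j"
    and disj: "disjoint_family_on (\<lambda>j. {a j<..b j}) J"
  shows "(LINT s|lborel. jump_exponent (\<Sum>j\<in>J. t j * indicator {a j<..b j} s)) =
    (\<Sum>j\<in>J. (b j - a j) * jump_exponent (t j))"
proof -
  have "jump_exponent (\<Sum>j\<in>J. t j * indicator {a j<..b j} s) = (\<Sum>j\<in>J. indicator {a j<..b j} s * jump_exponent (t j))" for s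
  proof (cases "\<exists>j\<in>J. s \<in> {a j<..b j}")
    case True
    then obtain j where j: "j \<in> J" "s \<in> {a j<..b j}" by blast
    have z: "s \<notin> {a i<..b i}" if "i \<in> J - {j}" for i
      using disjoint_family_onD[OF disj, of i j] j that by blast
    have "(\<Sum>i\<in>J. F i * indicator {a i<..b i} s) = F j" for F :: "_ \<Rightarrow> real"
    proof -
      have "(\<Sum>i\<in>J. F i * indicator {a i<..b i} s) = F j * indicator {a j<..b j} s + (\<Sum>i\<in>J-{j}. F i * indicator {a i<..b i} s)"
        using J j(1) by (rule sum.remove)
      also have "(\<Sum>i\<in>J-{j}. F i * indicator {a i<..b i} s) = 0" using z by (intro sum.neutral) auto
      finally show ?thesis using j(2) by simp
    qed
    from this[of t] this[of "\<lambda>j. jump_exponent (t j)"] show ?thesis by (simp add: mult.commute)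
  next
    case False
    then have "(\<Sum>i\<in>J. F i * indicator {a i<..b i} s) = 0" for F :: "_ \<Rightarrow> real"
      by (intro sum.neutral) auto
    from this[of t] this[of "\<lambda>j. jump_exponent (t j)"] show ?thesis by (simp add: mult.commute jump_exponent_0)
  qed
  then have "(LINT s|lborel. jump_exponent (\<Sum>j\<in>J. t j * indicator {a j<..b j} s)) =
      (LINT s|lborel. (\<Sum>j\<in>J. indicator {a j<..b j} s * jump_exponent (t j)))" by simp
  also have "\<dots> = (\<Sum>j\<in>J. LINT s|lborel. indicator {a j<..b j} s * jump_exponent (t j))"
    by (intro Bochner_Integration.integral_sum integrable_mult_left integrable_indicator_Ioc)
  also have "\<dots> = (\<Sum>j\<in>J. (b j - a j) * jump_exponent (t j))"
    using ab by (intro sum.cong refl) simp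
  finally show ?thesis .
qed

text \<open>\<open>\<xi> \<tau>\<close> is the sum of the jumps in \<open>(0, \<tau>]\<close> of a Poisson cloud with intensity \<open>ds \<otimes> \<nu>\<close>. The last
conclusion holds the whole probabilistic content: it is the joint Laplace transform of increments
over disjoint intervals.\<close>
lemma exists_pure_jump_process:
  obtains Q :: "(nat \<Rightarrow> nat \<times> (nat \<Rightarrow> real \<times> real)) measure" and \<xi>
  where "prob_space Q" "\<And>\<tau>. \<xi> \<tau> \<in> borel_measurable Q" "\<And>\<omega>. \<xi> 0 \<omega> = 0"
    "\<And>\<omega>. \<omega> \<in> space Q \<Longrightarrow> mono_on {0..} (\<lambda>\<tau>. \<xi> \<tau> \<omega>)"
    "\<And>\<tau> \<omega>. 0 \<le> \<tau> \<Longrightarrow> \<omega> \<in> space Q \<Longrightarrow> continuous (at_right \<tau>) (\<lambda>s. \<xi> s \<omega>)"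
    "\<And>(J :: nat set) t a b. finite J \<Longrightarrow> (\<And>j. j \<in> J \<Longrightarrow> 0 \<le> t j \<and> 0 \<le> a j \<and> a j \<le> b j) \<Longrightarrow>
      disjoint_family_on (\<lambda>j. {a j<..b j}) J \<Longrightarrow>
      (LINT \<omega>|Q. exp (- (\<Sum>j\<in>J. t j * (\<xi> (b j) \<omega> - \<xi> (a j) \<omega>)))) =
      exp (- (\<Sum>j\<in>J. (b j - a j) * jump_exponent (t j)))"
proof -
  interpret P: pair_sigma_finite "lborel :: real measure" \<nu> ..
  define m where "m = (lborel :: real measure) \<Otimes>\<^sub>M \<nu>"
  have sf: "sigma_finite_measure m" unfolding m_def ..
  have ne: "space m \<noteq> {}" by (simp add: m_def space_pair_measure space_\<nu>)
  show ?thesis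
  proof (rule exists_poisson_process[OF sf ne])
    fix Q :: "(nat \<Rightarrow> nat \<times> (nat \<Rightarrow> real \<times> real)) measure"
      and N :: "nat \<Rightarrow> (nat \<Rightarrow> nat \<times> (nat \<Rightarrow> real \<times> real)) \<Rightarrow> nat" and Z
    assume Q: "prob_space Q" and N: "\<And>k. N k \<in> measurable Q (count_space UNIV)"
      and Z: "\<And>k i. Z k i \<in> measurable Q m"
      and cloud: "\<And>h :: real \<times> real \<Rightarrow> real. h \<in> borel_measurable m \<Longrightarrow> (\<And>x. x \<in> space m \<Longrightarrow> 0 \<le> h x) \<Longrightarrow>
         integrable m (\<lambda>x. 1 - exp (- h x)) \<Longrightarrow>
         (AE \<omega> in Q. summable (\<lambda>k. \<Sum>i<N k \<omega>. h (Z k i \<omega>))) \<and>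
         (LINT \<omega>|Q. exp (- (\<Sum>k. \<Sum>i<N k \<omega>. h (Z k i \<omega>)))) = exp (- (LINT x|m. 1 - exp (- h x)))"
    interpret Q: prob_space Q by fact
    have snd_m: "snd \<in> borel_measurable m"
      unfolding m_def by (rule measurable_compose[OF measurable_snd id_measurable])
    have fst_m: "fst \<in> borel_measurable m"
      unfolding m_def using measurable_fst[of lborel \<nu>] by simp
    have jump_pos: "0 < snd (Z k i \<omega>)" if "\<omega> \<in> space Q" for k i \<omega>
      using measurable_space[OF Z that, of k i] by (auto simp: m_def space_pair_measure space_\<nu>)
    define W where "W w k \<omega> = (\<Sum>i<N k \<omega>. w (fst (Z k i \<omega>)) * snd (Z k i \<omega>))" for w :: "real \<Rightarrow> real" and k \<omega>
    have W_meas: "W w k \<in> borel_measurable Q" if w: "w \<in> borel_measurable borel" for w k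
      unfolding W_def[abs_def]
      by (rule measurable_compose_countable[OF _ N, of "\<lambda>n \<omega>. \<Sum>i<n. w (fst (Z k i \<omega>)) * snd (Z k i \<omega>)"])
        (intro borel_measurable_sum borel_measurable_times
          measurable_compose[OF measurable_compose[OF Z fst_m] w] measurable_compose[OF Z snd_m])
    have W_law: "(AE \<omega> in Q. summable (\<lambda>k. W w k \<omega>)) \<and>
        (LINT \<omega>|Q. exp (- (\<Sum>k. W w k \<omega>))) = exp (- (LINT s|lborel. jump_exponent (w s)))"
      if w: "w \<in> borel_measurable borel" "\<And>s. 0 \<le> w s" "\<And>s. w s \<le> c" "\<And>s. s \<notin> {0<..T} \<Longrightarrow> w s = 0"
      for w c T
    proof -
      have "(\<lambda>p. w (fst p) * snd p) \<in> borel_measurable m"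
        by (intro borel_measurable_times measurable_compose[OF fst_m w(1)] snd_m)
      moreover have "0 \<le> w (fst p) * snd p" if "p \<in> space m" for p
        using that w(2)[of "fst p"] by (auto simp: m_def space_pair_measure space_\<nu>)
      ultimately show ?thesis
        using cloud[of "\<lambda>p. w (fst p) * snd p"] strip_integral[OF w] by (simp add: m_def W_def)
    qed
    \<comment> \<open>monotonicity in time reduces summability at all times to countably many almost sure events;
      outside their intersection the path is replaced by a constant, since path properties are required everywhere\<close>
    define good where "good \<omega> \<longleftrightarrow> (\<forall>T::nat. summable (\<lambda>k. W (indicator {0<..real T}) k \<omega>))" for \<omega>
    have good_ae: "AE \<omega> in Q. good \<omega>"
      unfolding good_def AE_all_countable
      by (intro allI W_law[THEN conjunct1, of _ 1]) (auto simp: indicator_def)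
    have good_meas: "Measurable.pred Q good"
    proof -
      have [measurable]: "Measurable.pred Q (\<lambda>\<omega>. summable (\<lambda>k. W (indicator {0<..real T}) k \<omega>))" for T
        by (intro pred_summable W_meas) simp
      show ?thesis unfolding good_def[abs_def] by measurable
    qed
    have W_nonneg: "0 \<le> W w k \<omega>" if "\<omega> \<in> space Q" "\<And>s. 0 \<le> w s" for w k \<omega>
      unfolding W_def using that jump_pos[OF that(1)] by (intro sum_nonneg) (simp add: less_imp_le)
    have W_mono: "W w k \<omega> \<le> W w' k \<omega>" if "\<omega> \<in> space Q" "\<And>s. w s \<le> w' s" for w w' k \<omega>
      unfolding W_def using that jump_pos[OF that(1)]
      by (intro sum_mono mult_right_mono) (auto simp: less_imp_le)
    define I where "I \<tau> = (indicator {0<..\<tau>} :: real \<Rightarrow> real)" for \<tau> :: real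
    have I_mono: "I \<sigma> s \<le> I \<tau> s" if "\<sigma> \<le> \<tau>" for \<sigma> \<tau> s using that by (auto simp: I_def indicator_def)
    have I_nonneg: "0 \<le> I \<tau> s" for \<tau> s by (simp add: I_def)
    have I_meas: "I \<tau> \<in> borel_measurable borel" for \<tau> by (simp add: I_def)
    have summ: "summable (\<lambda>k. W (I \<tau>) k \<omega>)" if "good \<omega>" "\<omega> \<in> space Q" for \<tau> \<omega>
    proof (rule summable_comparison_test')
      show "summable (\<lambda>k. W (I (real (nat \<lceil>\<tau>\<rceil>))) k \<omega>)" using that(1) by (simp add: good_def I_def)
      show "norm (W (I \<tau>) k \<omega>) \<le> W (I (real (nat \<lceil>\<tau>\<rceil>))) k \<omega>" for k
        using W_nonneg[OF that(2) I_nonneg] W_mono[OF that(2) I_mono[of \<tau> "real (nat \<lceil>\<tau>\<rceil>)"]]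
        by (simp add: real_nat_ceiling_ge)
    qed
    define \<xi> where "\<xi> \<tau> \<omega> = (if good \<omega> then \<Sum>k. W (I \<tau>) k \<omega> else 0)" for \<tau> \<omega>
    have \<xi>_meas: "\<xi> \<tau> \<in> borel_measurable Q" for \<tau>
    proof -
      note good_meas [measurable]
      have [measurable]: "W (I \<tau>) k \<in> borel_measurable Q" for k by (rule W_meas[OF I_meas])
      show ?thesis unfolding \<xi>_def[abs_def] by measurable
    qed
    have \<xi>_0: "\<xi> 0 \<omega> = 0" for \<omega> by (simp add: \<xi>_def W_def I_def)
    have \<xi>_mono: "mono_on {0..} (\<lambda>\<tau>. \<xi> \<tau> \<omega>)" if "\<omega> \<in> space Q" for \<omega>
      using that by (auto simp: \<xi>_def intro!: mono_onI suminf_le summ W_mono I_mono)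
    have \<xi>_cont: "continuous (at_right \<tau>) (\<lambda>s. \<xi> s \<omega>)" if "0 \<le> \<tau>" "\<omega> \<in> space Q" for \<tau> \<omega>
    proof (cases "good \<omega>")
      case False
      then show ?thesis by (simp add: \<xi>_def)
    next
      case True
      \<comment> \<open>the interval \<open>(0, s]\<close> is closed on the right, which makes a jump at \<open>\<tau>\<close> already count at \<open>\<tau>\<close>\<close>
      have I_cont: "((\<lambda>s. I s x) \<longlongrightarrow> I \<tau> x) (at_right \<tau>)" for x
      proof (rule tendsto_eventually)
        show "\<forall>\<^sub>F s in at_right \<tau>. I s x = I \<tau> x"
        proof (cases "x \<le> \<tau>")
          case True
          then show ?thesis unfolding eventually_at_right_field
            by (intro exI[of _ "\<tau> + 1"]) (auto simp: I_def indicator_def)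
        next
          case False
          then show ?thesis unfolding eventually_at_right_field
            by (intro exI[of _ x]) (auto simp: I_def indicator_def)
        qed
      qed
      have "((\<lambda>s. \<Sum>k. W (I s) k \<omega>) \<longlongrightarrow> (\<Sum>k. W (I \<tau>) k \<omega>)) (at_right \<tau>)"
      proof (rule swap_uniform_limit')
        show "uniform_limit {..\<tau> + 1} (\<lambda>n s. \<Sum>k<n. W (I s) k \<omega>) (\<lambda>s. \<Sum>k. W (I s) k \<omega>) sequentially"
          by (rule Weierstrass_m_test[OF _ summ[OF True that(2), of "\<tau> + 1"]])
            (use W_nonneg[OF that(2) I_nonneg] W_mono[OF that(2) I_mono] in auto)
        show "\<forall>\<^sub>F s in at_right \<tau>. s \<in> {..\<tau> + 1}"
          unfolding eventually_at_right_field by (intro exI[of _ "\<tau> + 1"]) auto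
        show "\<forall>\<^sub>F n in sequentially. ((\<lambda>s. \<Sum>k<n. W (I s) k \<omega>) \<longlongrightarrow> (\<Sum>k<n. W (I \<tau>) k \<omega>)) (at_right \<tau>)"
          unfolding W_def by (intro always_eventually allI tendsto_sum tendsto_mult tendsto_const I_cont)
        show "(\<lambda>n. \<Sum>k<n. W (I \<tau>) k \<omega>) \<longlonglongrightarrow> (\<Sum>k. W (I \<tau>) k \<omega>)"
          by (rule summable_LIMSEQ[OF summ[OF True that(2)]])
      qed simp
      then show ?thesis using True by (simp add: continuous_within \<xi>_def)
    qed
    have \<xi>_law: "(LINT \<omega>|Q. exp (- (\<Sum>j\<in>J. t j * (\<xi> (b j) \<omega> - \<xi> (a j) \<omega>)))) =
        exp (- (\<Sum>j\<in>J. (b j - a j) * jump_exponent (t j)))"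
      if J: "finite J" and tab: "\<And>j. j \<in> J \<Longrightarrow> 0 \<le> t j \<and> 0 \<le> a j \<and> a j \<le> b j"
        and disj: "disjoint_family_on (\<lambda>j. {a j<..b j}) J" for J :: "nat set" and t a b
    proof -
      define w where "w s = (\<Sum>j\<in>J. t j * indicator {a j<..b j} s)" for s :: real
      have wI: "w s = (\<Sum>j\<in>J. t j * (I (b j) s - I (a j) s))" for s
        unfolding w_def using tab by (intro sum.cong refl) (fastforce simp: I_def indicator_def)
      have w_meas: "w \<in> borel_measurable borel" unfolding w_def[abs_def] by measurable
      have w_supp: "w s = 0" if "s \<notin> {0<..\<Sum>j\<in>J. b j}" for s
        unfolding w_def
      proof (intro sum.neutral ballI)
        fix j assume j: "j \<in> J"
        have "b j \<le> (\<Sum>j\<in>J. b j)" using j J tab by (intro member_le_sum) (auto intro: order_trans)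
        then have "s \<notin> {a j<..b j}" using \<open>s \<notin> _\<close> tab[OF j] by auto
        then show "t j * indicator {a j<..b j} s = 0" by simp
      qed
      have w_le: "w s \<le> (\<Sum>j\<in>J. t j)" for s
        unfolding w_def using tab by (intro sum_mono) (auto simp: indicator_def)
      have w_nonneg: "0 \<le> w s" for s
        unfolding w_def using tab by (intro sum_nonneg) auto
      have eq: "(\<Sum>j\<in>J. t j * (\<xi> (b j) \<omega> - \<xi> (a j) \<omega>)) = (\<Sum>k. W w k \<omega>)"
        if "good \<omega>" "\<omega> \<in> space Q" for \<omega>
      proof -
        note s = summ[OF that]
        have "(\<Sum>j\<in>J. t j * (\<xi> (b j) \<omega> - \<xi> (a j) \<omega>)) = (\<Sum>j\<in>J. \<Sum>k. t j * (W (I (b j)) k \<omega> - W (I (a j)) k \<omega>))"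
          using that(1) s by (simp add: \<xi>_def suminf_diff suminf_mult summable_diff)
        also have "\<dots> = (\<Sum>k. \<Sum>j\<in>J. t j * (W (I (b j)) k \<omega> - W (I (a j)) k \<omega>))"
          using s by (intro suminf_sum[symmetric] summable_mult summable_diff)
        also have "\<dots> = (\<Sum>k. W w k \<omega>)"
        proof (rule suminf_cong)
          fix k
          have "(\<Sum>j\<in>J. t j * (W (I (b j)) k \<omega> - W (I (a j)) k \<omega>)) =
              (\<Sum>j\<in>J. \<Sum>i<N k \<omega>. t j * (I (b j) (fst (Z k i \<omega>)) - I (a j) (fst (Z k i \<omega>))) * snd (Z k i \<omega>))"
            by (simp add: W_def sum_subtractf[symmetric] sum_distrib_left algebra_simps)
          also have "\<dots> = W w k \<omega>"
            unfolding W_def wI by (subst sum.swap) (simp add: sum_distrib_right)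
          finally show "(\<Sum>j\<in>J. t j * (W (I (b j)) k \<omega> - W (I (a j)) k \<omega>)) = W w k \<omega>" .
        qed
        finally show ?thesis .
      qed
      have Wm [measurable]: "W w k \<in> borel_measurable Q" for k by (rule W_meas[OF w_meas])
      note \<xi>_meas [measurable]
      have "(LINT \<omega>|Q. exp (- (\<Sum>j\<in>J. t j * (\<xi> (b j) \<omega> - \<xi> (a j) \<omega>)))) = (LINT \<omega>|Q. exp (- (\<Sum>k. W w k \<omega>)))"
      proof (rule integral_cong_AE)
        show "AE \<omega> in Q. exp (- (\<Sum>j\<in>J. t j * (\<xi> (b j) \<omega> - \<xi> (a j) \<omega>))) = exp (- (\<Sum>k. W w k \<omega>))"
          using good_ae AE_space by eventually_elim (simp add: eq)
      qed measurable
      also have "\<dots> = exp (- (LINT s|lborel. jump_exponent (w s)))"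
        using W_law[OF w_meas w_nonneg w_le w_supp] by blast
      also have "(LINT s|lborel. jump_exponent (w s)) = (\<Sum>j\<in>J. (b j - a j) * jump_exponent (t j))"
        unfolding w_def using J tab disj by (intro jump_exponent_step) auto
      finally show ?thesis .
    qed
    show ?thesis
      by (rule that[OF Q \<xi>_meas \<xi>_0 \<xi>_mono \<xi>_cont \<xi>_law])
  qed
qed

end

text \<open>Adding the drift multiplies the joint transform of the increments by a factor that splits over the
intervals as well, so it remains a product, and the increments are independent.\<close>
lemma exists_associated_process:
  assumes f: "impulse_response_form L K \<nu> f"
  shows "\<exists>(M :: (nat \<Rightarrow> nat \<times> (nat \<Rightarrow> real \<times> real)) measure) X. associated_process f M X"
proof -
  have L: "0 \<le> L" and K: "0 \<le> K"
    and f_eq: "\<And>t. 0 \<le> t \<Longrightarrow> f t = L + K * t + (LINT x|\<nu>. 1 - exp (- t * x))"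
    using f by (auto simp: impulse_response_form_def)
  interpret levy_measure \<nu>
    using f by unfold_locales (auto simp: impulse_response_form_def)
  show ?thesis
  proof (rule exists_pure_jump_process)
    fix Q :: "(nat \<Rightarrow> nat \<times> (nat \<Rightarrow> real \<times> real)) measure" and \<xi>
      assume Q: "prob_space Q" and meas: "\<And>\<tau>. \<xi> \<tau> \<in> borel_measurable Q" and \<xi>_0: "\<And>\<omega>. \<xi> 0 \<omega> = 0"
      and mono: "\<And>\<omega>. \<omega> \<in> space Q \<Longrightarrow> mono_on {0..} (\<lambda>\<tau>. \<xi> \<tau> \<omega>)"
      and cont: "\<And>\<tau> \<omega>. 0 \<le> \<tau> \<Longrightarrow> \<omega> \<in> space Q \<Longrightarrow> continuous (at_right \<tau>) (\<lambda>s. \<xi> s \<omega>)"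
      and law: "\<And>(J :: nat set) t a b. finite J \<Longrightarrow> (\<And>j. j \<in> J \<Longrightarrow> 0 \<le> t j \<and> 0 \<le> a j \<and> a j \<le> b j) \<Longrightarrow>
        disjoint_family_on (\<lambda>j. {a j<..b j}) J \<Longrightarrow>
        (LINT \<omega>|Q. exp (- (\<Sum>j\<in>J. t j * (\<xi> (b j) \<omega> - \<xi> (a j) \<omega>)))) =
        exp (- (\<Sum>j\<in>J. (b j - a j) * jump_exponent (t j)))"
    interpret Q: prob_space Q by fact
    define X where "X \<tau> \<omega> = L + K * \<tau> + \<xi> \<tau> \<omega>" for \<tau> \<omega>
    have X_meas [measurable]: "X \<tau> \<in> borel_measurable Q" for \<tau>
      unfolding X_def[abs_def] using meas[of \<tau>] by measurable
    have X_0: "X 0 \<omega> = L" for \<omega> by (simp add: X_def \<xi>_0)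
    have X_mono: "mono_on {0..} (\<lambda>\<tau>. X \<tau> \<omega>)" if "\<omega> \<in> space Q" for \<omega>
      using mono[OF that] K by (auto simp: X_def mono_on_def intro!: add_mono mult_left_mono)
    have X_inc: "0 \<le> X \<tau> \<omega> - X \<sigma> \<omega>" if "0 \<le> \<sigma>" "\<sigma> \<le> \<tau>" "\<omega> \<in> space Q" for \<sigma> \<tau> \<omega>
      using mono_onD[OF X_mono[OF that(3)], of \<sigma> \<tau>] that by auto
    have X_law: "(LINT \<omega>|Q. (\<Prod>j\<in>J. exp (- t j * (X (b j) \<omega> - X (a j) \<omega>)))) =
        (\<Prod>j\<in>J. exp (- (b j - a j) * (f (t j) - L)))"
      if "finite J" and tab: "\<And>j. j \<in> J \<Longrightarrow> 0 \<le> t j \<and> 0 \<le> a j \<and> a j \<le> b j"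
        and "disjoint_family_on (\<lambda>j. {a j<..b j}) J" for J :: "nat set" and t a b
    proof -
      have "(LINT \<omega>|Q. (\<Prod>j\<in>J. exp (- t j * (X (b j) \<omega> - X (a j) \<omega>)))) =
          (LINT \<omega>|Q. exp (- (\<Sum>j\<in>J. t j * K * (b j - a j))) * exp (- (\<Sum>j\<in>J. t j * (\<xi> (b j) \<omega> - \<xi> (a j) \<omega>))))"
      proof (rule Bochner_Integration.integral_cong[OF refl])
        fix \<omega>
        have "(\<Prod>j\<in>J. exp (- t j * (X (b j) \<omega> - X (a j) \<omega>))) =
            exp (\<Sum>j\<in>J. - (t j * K * (b j - a j)) - t j * (\<xi> (b j) \<omega> - \<xi> (a j) \<omega>))"
          unfolding exp_sum[OF \<open>finite J\<close>] by (intro prod.cong refl arg_cong[where f=exp]) (simp add: X_def algebra_simps)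
        also have "(\<Sum>j\<in>J. - (t j * K * (b j - a j)) - t j * (\<xi> (b j) \<omega> - \<xi> (a j) \<omega>)) =
            - (\<Sum>j\<in>J. t j * K * (b j - a j)) + - (\<Sum>j\<in>J. t j * (\<xi> (b j) \<omega> - \<xi> (a j) \<omega>))"
          by (simp add: sum_subtractf sum_negf)
        finally show "(\<Prod>j\<in>J. exp (- t j * (X (b j) \<omega> - X (a j) \<omega>))) =
            exp (- (\<Sum>j\<in>J. t j * K * (b j - a j))) * exp (- (\<Sum>j\<in>J. t j * (\<xi> (b j) \<omega> - \<xi> (a j) \<omega>)))"
          by (simp only: exp_add)
      qed
      also have "\<dots> = exp (- (\<Sum>j\<in>J. t j * K * (b j - a j))) * exp (- (\<Sum>j\<in>J. (b j - a j) * jump_exponent (t j)))"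
        using law[OF that] by simp
      also have "\<dots> = exp (\<Sum>j\<in>J. - (t j * K * (b j - a j)) - (b j - a j) * jump_exponent (t j))"
        by (simp add: exp_add[symmetric] sum_subtractf sum_negf)
      also have "\<dots> = (\<Prod>j\<in>J. exp (- (b j - a j) * (f (t j) - L)))"
        unfolding exp_sum[OF \<open>finite J\<close>] using tab
        by (intro prod.cong refl arg_cong[where f=exp]) (simp add: f_eq jump_exponent_def algebra_simps)
      finally show ?thesis .
    qed
    have X_law1: "(LINT \<omega>|Q. exp (- t * (X \<tau> \<omega> - X \<sigma> \<omega>))) = exp (- (\<tau> - \<sigma>) * (f t - L))"
      if "0 \<le> t" "0 \<le> \<sigma>" "\<sigma> \<le> \<tau>" for t \<sigma> \<tau>
      using X_law[of "{0}" "\<lambda>_. t" "\<lambda>_. \<sigma>" "\<lambda>_. \<tau>"] that by (simp add: disjoint_family_on_def)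
    have "subordinator Q X"
    proof
      show "X \<tau> \<in> borel_measurable Q" if "0 \<le> \<tau>" for \<tau> by measurable
      show "0 \<le> X \<tau> \<omega>" if "0 \<le> \<tau>" "\<omega> \<in> space Q" for \<tau> \<omega>
        using X_inc[of 0 \<tau> \<omega>] that L by (simp add: X_0)
      show "mono_on {0..} (\<lambda>\<tau>. X \<tau> \<omega>)" if "\<omega> \<in> space Q" for \<omega> by (rule X_mono[OF that])
      show "continuous (at_right \<tau>) (\<lambda>s. X s \<omega>)" if "0 \<le> \<tau>" "\<omega> \<in> space Q" for \<tau> \<omega>
        unfolding X_def by (intro continuous_intros cont that)
      show "distr Q borel (\<lambda>\<omega>. X \<tau> \<omega> - X \<sigma> \<omega>) = distr Q borel (\<lambda>\<omega>. X \<tau>' \<omega> - X \<sigma>' \<omega>)"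
        if "0 \<le> \<sigma>" "\<sigma> \<le> \<tau>" "0 \<le> \<sigma>'" "\<sigma>' \<le> \<tau>'" "\<tau> - \<sigma> = \<tau>' - \<sigma>'" for \<sigma> \<tau> \<sigma>' \<tau>'
        by (rule distr_eqI_Laplace[OF Q Q])
          (use that in \<open>auto simp only: X_law1 intro!: X_inc AE_I2 borel_measurable_diff X_meas\<close>)
      fix n :: nat and \<tau> :: "nat \<Rightarrow> real"
      assume \<tau>: "\<tau> 0 = 0" "strict_mono_on {0..n} \<tau>"
      have le: "\<tau> i \<le> \<tau> j" if "i \<le> j" "j \<le> n" for i j
        using strict_mono_on_leD[OF \<tau>(2), of i j] that by simp
      have grid: "0 \<le> \<tau> (i - 1)" "\<tau> (i - 1) \<le> \<tau> i" if "i \<le> n" for i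
        using le[of 0 "i - 1"] le[of "i - 1" i] \<tau>(1) that by auto
      have disj: "disjoint_family_on (\<lambda>i. {\<tau> (i - 1)<..\<tau> i}) {1..n}"
        unfolding disjoint_family_on_def
      proof (intro ballI impI)
        fix i j assume ij: "i \<in> {1..n}" "j \<in> {1..n}" "i \<noteq> j"
        have "\<tau> i \<le> \<tau> (j - 1) \<or> \<tau> j \<le> \<tau> (i - 1)"
          using ij le[of i "j - 1"] le[of j "i - 1"] by fastforce
        then show "{\<tau> (i - 1)<..\<tau> i} \<inter> {\<tau> (j - 1)<..\<tau> j} = {}" by auto
      qed
      define Y where "Y i \<omega> = (if i = 0 then X 0 \<omega> else X (\<tau> i) \<omega> - X (\<tau> (i - 1)) \<omega>)" for i \<omega>
      have "Q.indep_vars (\<lambda>_. borel) Y {0..n}"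
      proof (rule Q.indep_vars_Laplace)
        show "Y i \<in> borel_measurable Q" for i unfolding Y_def[abs_def] by measurable
        show "AE \<omega> in Q. 0 \<le> Y i \<omega>" if "i \<in> {0..n}" for i
          using that grid[of i] L by (intro AE_I2) (auto simp: Y_def X_0 X_inc simp del: One_nat_def diff_ge_0_iff_ge)
        fix t :: "nat \<Rightarrow> real" assume t: "\<And>i. i \<in> {0..n} \<Longrightarrow> 0 \<le> t i"
        have split: "{0..n} = insert 0 {1..n}" by auto
        have Y0: "Y 0 \<omega> = L" for \<omega> by (simp add: Y_def X_0)
        have Yi: "Y i \<omega> = X (\<tau> i) \<omega> - X (\<tau> (i - 1)) \<omega>" if "i \<in> {1..n}" for i \<omega>
          using that by (auto simp: Y_def)
        have ins: "(\<Prod>i\<in>{0..n}. F i) = F 0 * (\<Prod>i\<in>{1..n}. F i)" for F :: "nat \<Rightarrow> real"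
          unfolding split by (rule prod.insert) auto
        have "(\<Prod>i\<in>{0..n}. exp (- t i * Y i \<omega>)) =
            exp (- t 0 * L) * (\<Prod>i\<in>{1..n}. exp (- t i * (X (\<tau> i) \<omega> - X (\<tau> (i - 1)) \<omega>)))" for \<omega>
          unfolding ins Y0 by (intro arg_cong2[where f="(*)"] refl prod.cong) (simp only: Yi)
        then have "(LINT \<omega>|Q. (\<Prod>i\<in>{0..n}. exp (- t i * Y i \<omega>))) =
            exp (- t 0 * L) * (LINT \<omega>|Q. (\<Prod>i\<in>{1..n}. exp (- t i * (X (\<tau> i) \<omega> - X (\<tau> (i - 1)) \<omega>))))"
          by (simp only: integral_mult_right_zero)
        also have "\<dots> = exp (- t 0 * L) * (\<Prod>i\<in>{1..n}. exp (- (\<tau> i - \<tau> (i - 1)) * (f (t i) - L)))"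
          using X_law[of "{1..n}" t "\<lambda>i. \<tau> (i - 1)" \<tau>] t grid disj by simp
        also have "\<dots> = (LINT \<omega>|Q. exp (- t 0 * L)) * (\<Prod>i\<in>{1..n}. LINT \<omega>|Q. exp (- t i * Y i \<omega>))"
        proof (intro arg_cong2[where f="(*)"] prod.cong refl)
          show "exp (- t 0 * L) = (LINT \<omega>|Q. exp (- t 0 * L))" by (simp add: Q.prob_space)
          fix i assume i: "i \<in> {1..n}"
          then show "exp (- (\<tau> i - \<tau> (i - 1)) * (f (t i) - L)) = (LINT \<omega>|Q. exp (- t i * Y i \<omega>))"
            unfolding Yi[OF i] using t grid[of i] by (intro X_law1[symmetric]) auto
        qed
        also have "\<dots> = (\<Prod>i\<in>{0..n}. LINT \<omega>|Q. exp (- t i * Y i \<omega>))"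
          unfolding ins Y0 ..
        finally show "(LINT \<omega>|Q. (\<Prod>i\<in>{0..n}. exp (- t i * Y i \<omega>))) =
            (\<Prod>i\<in>{0..n}. LINT \<omega>|Q. exp (- t i * Y i \<omega>))" .
      qed auto
      then show "Q.indep_vars (\<lambda>_. borel)
          (\<lambda>i \<omega>. if i = 0 then X 0 \<omega> else X (\<tau> i) \<omega> - X (\<tau> (i - 1)) \<omega>) {0..n}"
        by (simp only: Y_def[abs_def])
    qed
    then have "associated_process f Q X"
      unfolding associated_process_def using f X_law1
      by (intro conjI exI[of _ L] exI[of _ K] exI[of _ \<nu>]) (auto simp: X_0)
    then show ?thesis by blast
  qed
qed

section \<open>The Levy--Khintchine representation of the Laplace exponent\<close>

text \<open>The continuous extension to the real line, constant outside \<open>[0, 1]\<close>, of the quotient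
\<open>(1 - exp (- t * x)) / (1 - exp (- x))\<close> in the variable \<open>u = exp (- x)\<close>. The value \<open>1\<close> at \<open>u = 0\<close>
belongs to \<open>x = \<infinity>\<close>, the value \<open>t\<close> at \<open>u = 1\<close> to \<open>x = 0\<close>.\<close>
definition slope :: "real \<Rightarrow> real \<Rightarrow> real" where
  "slope t u = (if u \<le> 0 then 1 else if 1 \<le> u then t else (1 - u powr t) / (1 - u))"

lemma slope_exp: "0 < x \<Longrightarrow> slope t (exp (- x)) = (1 - exp (- t * x)) / (1 - exp (- x))"
  by (simp add: slope_def powr_def mult.commute)

lemma slope_bounds:
  assumes "0 < t" shows "0 \<le> slope t u" "slope t u \<le> 1 + t"
proof -
  have "0 \<le> slope t u \<and> slope t u \<le> 1 + t"
  proof (cases "0 < u \<and> u < 1")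
    case True
    define x where "x = - ln u"
    have u: "u = exp (- x)" and x: "0 < x" using True by (simp_all add: x_def)
    have "1 - exp (- t * x) \<le> (1 + t) * (x / (1 + x))" using x assms by (intro one_minus_exp_le) auto
    also have "\<dots> \<le> (1 + t) * (1 - exp (- x))" using x assms by (intro mult_left_mono le_one_minus_exp) auto
    finally show ?thesis using x assms unfolding u slope_exp[OF x]
      by (auto simp: divide_le_eq)
  next
    case False
    then show ?thesis using assms by (auto simp: slope_def)
  qed
  then show "0 \<le> slope t u" "slope t u \<le> 1 + t" by auto
qed

lemma slope_continuous:
  assumes t: "0 < t" shows "isCont (slope t) u"
proof -
  let ?q = "\<lambda>u. (1 - u powr t) / (1 - u)"
  consider "u < 0" | "u = 0" | "0 < u" "u < 1" | "u = 1" | "1 < u" by linarith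
  then show ?thesis
  proof cases
    case 1
    have "\<forall>\<^sub>F v in nhds u. slope t v = 1"
      using eventually_nhds_in_open[of "{..<0}" u] 1 by (auto elim!: eventually_mono simp: slope_def)
    then show ?thesis using isCont_cong[of "slope t" "\<lambda>_. 1" u] by simp
  next
    case 5
    have "\<forall>\<^sub>F v in nhds u. slope t v = t"
      using eventually_nhds_in_open[of "{1<..}" u] 5 by (auto elim!: eventually_mono simp: slope_def)
    then show ?thesis using isCont_cong[of "slope t" "\<lambda>_. t" u] by simp
  next
    case 3
    have "\<forall>\<^sub>F v in nhds u. slope t v = ?q v"
      using eventually_nhds_in_open[of "{0<..<1}" u] 3 by (auto elim!: eventually_mono simp: slope_def)
    moreover have "isCont ?q u" using 3 by (intro continuous_intros) auto
    ultimately show ?thesis using isCont_cong[of "slope t" ?q u] by simp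
  next
    case 2
    have "(?q \<longlongrightarrow> 1) (at_right 0)" using t by real_asymp
    moreover have "\<forall>\<^sub>F v in at_right 0. ?q v = slope t v"
      using eventually_at_right_less[of "0::real"] eventually_at_right_field[of "\<lambda>v. v < 1" "0::real"]
      by (auto simp: slope_def eventually_at_right_field intro!: exI[of _ 1])
    ultimately have r: "(slope t \<longlongrightarrow> 1) (at_right 0)" by (rule Lim_transform_eventually)
    have "\<forall>\<^sub>F v in at_left 0. 1 = slope t v"
      by (auto simp: slope_def eventually_at_left_field intro!: exI[of _ "-1"])
    then have "(slope t \<longlongrightarrow> 1) (at_left 0)" by (rule Lim_transform_eventually[OF tendsto_const])
    with r show ?thesis unfolding 2 isCont_def by (simp add: filterlim_split_at slope_def)
  next
    case 4
    have "(?q \<longlongrightarrow> t) (at_left 1)" using t by real_asymp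
    moreover have "\<forall>\<^sub>F v in at_left 1. ?q v = slope t v"
      by (auto simp: slope_def eventually_at_left_field intro!: exI[of _ 0])
    ultimately have l: "(slope t \<longlongrightarrow> t) (at_left 1)" by (rule Lim_transform_eventually)
    have "\<forall>\<^sub>F v in at_right 1. t = slope t v"
      by (auto simp: slope_def eventually_at_right_field intro!: exI[of _ 2])
    then have "(slope t \<longlongrightarrow> t) (at_right 1)" by (rule Lim_transform_eventually[OF tendsto_const])
    with l show ?thesis unfolding 4 isCont_def by (simp add: filterlim_split_at slope_def)
  qed
qed

lemma scaled_one_minus_exp_tendsto:
  "(\<lambda>n. real (Suc n) * (1 - exp (- (c / real (Suc n))))) \<longlonglongrightarrow> c"
proof -
  have "((\<lambda>x. x * (1 - exp (- (c / x)))) \<longlongrightarrow> c) at_top" by real_asymp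
  then show ?thesis
    by (rule filterlim_compose) (rule filterlim_compose[OF filterlim_real_sequentially filterlim_Suc])
qed

text \<open>Put \<open>k = Suc n\<close>. The number \<open>k (1 - exp (- \<phi> t / k))\<close> is the integral of \<open>1 - exp (- t * x)\<close> against
\<open>k\<close> times \<open>\<mu> n\<close>, and tends to \<open>\<phi> t\<close>. Dividing by its value at \<open>t = 1\<close> yields the integral of
\<open>slope t\<close> against a probability measure \<open>\<rho> n\<close> on \<open>[0, 1]\<close>. Such measures are tight, \<open>slope t\<close> is
bounded and continuous, and so \<open>\<phi> t / \<phi> 1\<close> is the integral of \<open>slope t\<close> against a weak limit \<open>R\<close>.
Splitting \<open>R\<close> at the end points of \<open>[0, 1]\<close> gives the drift and the Levy measure. If \<open>\<phi> 1 = 0\<close>, then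
\<open>\<phi>\<close> vanishes altogether.\<close>
lemma infinitely_divisible_exponent:
  fixes \<mu> :: "nat \<Rightarrow> real measure" and \<phi> :: "real \<Rightarrow> real"
  assumes \<mu>: "\<And>n. real_distribution (\<mu> n)" and pos: "\<And>n. AE x in \<mu> n. 0 \<le> x"
    and lap: "\<And>n t. 0 \<le> t \<Longrightarrow> (LINT x|\<mu> n. exp (- t * x)) = exp (- (\<phi> t / real (Suc n)))"
  shows "\<exists>K \<nu>. impulse_response_form 0 K \<nu> \<phi>"
proof -
  interpret \<mu>: real_distribution "\<mu> n" for n by (rule \<mu>)
  have ei: "integrable (\<mu> n) (\<lambda>x. exp (- t * x))" if "0 \<le> t" for n t
    using pos[of n] that by (intro \<mu>.integrable_const_bound[where B=1]) (auto elim!: eventually_mono)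
  have Elap: "(LINT x|\<mu> n. 1 - exp (- t * x)) = 1 - exp (- (\<phi> t / real (Suc n)))" if "0 \<le> t" for n t
    using ei[OF that] lap[OF that] \<mu>.prob_space by simp
  have \<phi>0: "\<phi> 0 = 0" using lap[of 0 0] \<mu>.prob_space by simp
  have \<phi>_lim: "(\<lambda>j. \<phi> (1 / real (Suc j))) \<longlonglongrightarrow> 0"
  proof -
    have "(\<lambda>j. LINT x|\<mu> 0. exp (- (1 / real (Suc j)) * x)) \<longlonglongrightarrow> (LINT x|\<mu> 0. 1)"
    proof (rule integral_dominated_convergence[where w="\<lambda>_. 1"])
      show "AE x in \<mu> 0. (\<lambda>j. exp (- (1 / real (Suc j)) * x)) \<longlonglongrightarrow> 1"
      proof (rule AE_I2)
        fix x
        have "(\<lambda>j. exp (- (1 / real (Suc j)) * x)) \<longlonglongrightarrow> exp (- 0 * x)"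
          using LIMSEQ_inverse_real_of_nat by (intro tendsto_intros) (simp add: inverse_eq_divide)
        then show "(\<lambda>j. exp (- (1 / real (Suc j)) * x)) \<longlonglongrightarrow> 1" by simp
      qed
      show "AE x in \<mu> 0. norm (exp (- (1 / real (Suc j)) * x)) \<le> 1" for j
        using pos[of 0] by (auto elim!: eventually_mono)
    qed simp_all
    moreover have "(LINT x|\<mu> 0. exp (- (1 / real (Suc j)) * x)) = exp (- \<phi> (1 / real (Suc j)))" for j
      using lap[of "1 / real (Suc j)" 0] by simp
    moreover have "(LINT x|\<mu> 0. 1::real) = 1" using \<mu>.prob_space by simp
    ultimately have "(\<lambda>j. exp (- \<phi> (1 / real (Suc j)))) \<longlonglongrightarrow> 1" by (simp only:)
    then have "(\<lambda>j. - ln (exp (- \<phi> (1 / real (Suc j))))) \<longlonglongrightarrow> - ln 1"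
      by (intro tendsto_intros) auto
    then show ?thesis by simp
  qed
  have compare: "1 - exp (- \<phi> t) \<le> (1 + t) * (1 - exp (- \<phi> 1))" if "0 \<le> t" for t
  proof -
    have "(LINT x|\<mu> 0. 1 - exp (- t * x)) \<le> (LINT x|\<mu> 0. (1 + t) * (1 - exp (- 1 * x)))"
    proof (rule integral_mono_AE)
      show "AE x in \<mu> 0. 1 - exp (- t * x) \<le> (1 + t) * (1 - exp (- 1 * x))"
        using pos[of 0]
      proof eventually_elim
        case (elim x)
        have "1 - exp (- t * x) \<le> (1 + t) * (x / (1 + x))" using elim that by (intro one_minus_exp_le) auto
        also have "\<dots> \<le> (1 + t) * (1 - exp (- x))" using elim that by (intro mult_left_mono le_one_minus_exp) auto
        finally show ?case by simp
      qed
    qed (use ei[of t 0] ei[of 1 0] that in auto)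
    then show ?thesis using Elap[OF that, of 0] Elap[of 1 0] by simp
  qed
  have \<phi>_nonneg: "0 \<le> \<phi> t" if "0 \<le> t" for t
  proof -
    have "0 \<le> (LINT x|\<mu> 0. 1 - exp (- t * x))"
      using pos[of 0] that by (intro integral_nonneg_AE) (auto elim!: eventually_mono)
    then show ?thesis using Elap[OF that, of 0] by simp
  qed
  show ?thesis
  proof (cases "\<phi> 1 = 0")
    case True
    have "\<phi> t = 0" if "0 \<le> t" for t
      using compare[OF that] \<phi>_nonneg[OF that] True by simp
    then have "impulse_response_form 0 0 (null_measure (restrict_space borel {0<..})) \<phi>"
      by (simp add: impulse_response_form_def)
    then show ?thesis by blast
  next
    case False
    with \<phi>_nonneg[of 1] have \<phi>1: "0 < \<phi> 1" by simp
    define b where "b n = 1 - exp (- (\<phi> 1 / real (Suc n)))" for n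
    have b: "0 < b n" for n using \<phi>1 by (simp add: b_def)
    \<comment> \<open>the normalised measures on \<open>[0, 1]\<close>: a density proportional to \<open>1 - exp (- x)\<close>, then \<open>u = exp (- x)\<close>\<close>
    define D where "D n = density (\<mu> n) (\<lambda>x. ennreal ((1 - exp (- x)) / b n))" for n
    define \<rho> where "\<rho> n = distr (D n) borel (\<lambda>x. exp (- x))" for n
    have int\<rho>: "(LINT u|\<rho> n. G u) = (LINT x|\<mu> n. (1 - exp (- x)) / b n * G (exp (- x)))"
      if [measurable]: "G \<in> borel_measurable borel" for G :: "real \<Rightarrow> real" and n
    proof -
      have "(LINT u|\<rho> n. G u) = (LINT x|D n. G (exp (- x)))"
        unfolding \<rho>_def by (rule integral_distr) (auto simp: D_def)
      also have "\<dots> = (LINT x|\<mu> n. (1 - exp (- x)) / b n * G (exp (- x)))"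
        unfolding D_def using pos[of n] b[of n]
        by (subst integral_density) (auto elim!: eventually_mono)
      finally show ?thesis .
    qed
    have \<rho>: "real_distribution (\<rho> n)" for n
    proof -
      have "emeasure (D n) (space (D n)) = (\<integral>\<^sup>+x. ennreal ((1 - exp (- x)) / b n) \<partial>\<mu> n)"
        unfolding D_def by (subst emeasure_density) (auto cong: nn_integral_cong_simp)
      also have "\<dots> = ennreal (LINT x|\<mu> n. (1 - exp (- x)) / b n)"
        using ei[of 1 n] pos[of n] b[of n]
        by (intro nn_integral_eq_integral) (auto elim!: eventually_mono)
      also have "(LINT x|\<mu> n. (1 - exp (- x)) / b n) = 1"
      proof -
        have "(LINT x|\<mu> n. 1 - exp (- x)) = b n" using Elap[of 1 n] by (simp add: b_def)
        then show ?thesis using b[of n] by simp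
      qed
      finally have "prob_space (D n)" by (intro prob_spaceI) simp
      then interpret Dn: prob_space "D n" .
      show ?thesis unfolding \<rho>_def
        by (rule Dn.real_distribution_distr) (simp add: D_def)
    qed
    interpret \<rho>: real_distribution "\<rho> n" for n by (rule \<rho>)
    have "tight \<rho>"
      unfolding tight_def
    proof (intro conjI allI impI \<rho>)
      fix \<epsilon> :: real assume "0 < \<epsilon>"
      have "measure (\<rho> n) {-1<..1} = 1" for n
      proof (subst \<rho>.prob_eq_1)
        show "AE u in \<rho> n. u \<in> {-1<..1}"
          unfolding \<rho>_def
        proof (subst AE_distr_iff)
          show "AE x in D n. exp (- x) \<in> {- 1<..1}"
            unfolding D_def using pos[of n]
            by (subst AE_density) (auto elim!: eventually_mono intro: less_trans[of _ 0])
        qed (auto simp: D_def)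
      qed simp
      then show "\<exists>a b. a < b \<and> (\<forall>n. 1 - \<epsilon> < measure (\<rho> n) {a<..b})"
        using \<open>0 < \<epsilon>\<close> by (intro exI[of _ "-1"] exI[of _ 1]) simp
    qed
    then obtain r R where r: "strict_mono (r :: nat \<Rightarrow> nat)" and R: "real_distribution R"
        and conv: "weak_conv_m (\<rho> \<circ> (\<lambda>n. n) \<circ> r) R"
      using tight_imp_convergent_subsubsequence[of \<rho> "\<lambda>n. n"] by (auto simp: strict_mono_def)
    interpret R: real_distribution R by fact
    have slope_m [measurable]: "slope t \<in> borel_measurable borel" for t
      unfolding slope_def[abs_def] by measurable
    have slope_i: "integrable R (slope t)" if "0 < t" for t
      using slope_bounds[OF that] by (intro R.integrable_const_bound[where B="1 + t"]) auto
    have ind_i: "integrable R (indicator A :: real \<Rightarrow> real)" if "A \<in> sets borel" for A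
      by (rule R.integrable_const_bound[where B=1]) (use that in \<open>auto simp: indicator_def\<close>)
    have rep: "\<phi> t = \<phi> 1 * (LINT u|R. slope t u)" if t: "0 < t" for t
    proof -
      have "(\<lambda>n. LINT u|\<rho> (r n). slope t u) \<longlonglongrightarrow> (LINT u|R. slope t u)"
        using weak_conv_imp_integral_bdd_continuous_conv[of "\<rho> \<circ> (\<lambda>n. n) \<circ> r" R "slope t" "1 + t"]
          conv R \<rho> slope_bounds[OF t] slope_continuous[OF t] by (simp add: comp_def)
      moreover have "(LINT u|\<rho> n. slope t u) = (real (Suc n) * (1 - exp (- (\<phi> t / real (Suc n))))) /
          (real (Suc n) * (1 - exp (- (\<phi> 1 / real (Suc n)))))" for n
      proof -
        have "(LINT u|\<rho> n. slope t u) = (LINT x|\<mu> n. (1 - exp (- t * x)) / b n)"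
          unfolding int\<rho>[OF slope_m]
        proof (rule integral_cong_AE)
          show "AE x in \<mu> n. (1 - exp (- x)) / b n * slope t (exp (- x)) = (1 - exp (- t * x)) / b n"
            using pos[of n]
          proof eventually_elim
            case (elim x)
            show ?case
            proof (cases "x = 0")
              case False
              with elim have "0 < x" by simp
              then show ?thesis by (simp add: slope_exp)
            qed simp
          qed
        qed measurable
        also have "\<dots> = (1 - exp (- (\<phi> t / real (Suc n)))) / b n"
          using Elap[of t n] t by simp
        finally show ?thesis by (simp add: b_def)
      qed
      moreover have "(\<lambda>n. (real (Suc n) * (1 - exp (- (\<phi> t / real (Suc n))))) /
          (real (Suc n) * (1 - exp (- (\<phi> 1 / real (Suc n)))))) \<longlonglongrightarrow> \<phi> t / \<phi> 1"
        using \<phi>1 by (intro tendsto_divide scaled_one_minus_exp_tendsto) auto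
      ultimately have "(\<lambda>n. LINT u|\<rho> n. slope t u) \<longlonglongrightarrow> \<phi> t / \<phi> 1"
        and *: "(\<lambda>n. LINT u|\<rho> (r n). slope t u) \<longlonglongrightarrow> (LINT u|R. slope t u)" by simp_all
      then have "(\<lambda>n. LINT u|\<rho> (r n). slope t u) \<longlonglongrightarrow> \<phi> t / \<phi> 1"
        using LIMSEQ_subseq_LIMSEQ[OF _ r] by (auto simp: comp_def)
      from LIMSEQ_unique[OF * this] show ?thesis using \<phi>1 by simp
    qed
    \<comment> \<open>mass at \<open>u = 0\<close> would keep \<open>\<phi> t\<close> away from \<open>0\<close> as \<open>t\<close> decreases to \<open>0\<close>, because
      \<open>slope t 0 = 1\<close> for every \<open>t\<close>\<close>
    have no_mass: "R.prob {..0} = 0"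
    proof -
      have "\<phi> 1 * R.prob {..0} \<le> \<phi> (1 / real (Suc j))" for j
      proof -
        let ?t = "1 / real (Suc j)"
        have "R.prob {..0} = (LINT u|R. indicator {..0} u)" by simp
        also have "\<dots> \<le> (LINT u|R. slope ?t u)"
        proof (intro integral_mono slope_i)
          show "integrable R (indicator {..0} :: real \<Rightarrow> real)" by (rule ind_i) simp
          show "indicator {..0} u \<le> slope ?t u" for u
            using slope_bounds(1)[of ?t u] by (cases "u \<le> 0") (simp_all add: slope_def[of _ u])
        qed simp
        finally show ?thesis using rep[of ?t] \<phi>1 by simp
      qed
      then have "\<phi> 1 * R.prob {..0} \<le> 0" by (intro LIMSEQ_le_const[OF \<phi>_lim]) auto
      then show ?thesis using \<phi>1 by (simp add: mult_le_0_iff measure_le_0_iff)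
    qed
    define K where "K = \<phi> 1 * R.prob {1..}"
    define w where "w u = indicator {0<..<1} u * (\<phi> 1 / (1 - u))" for u :: real
    \<comment> \<open>the value \<open>1\<close> off \<open>(0, 1)\<close>, where the density \<open>w\<close> vanishes, is arbitrary; it keeps \<open>lg\<close> positive\<close>
    define lg where "lg u = (if 0 < u \<and> u < 1 then - ln u else 1)" for u :: real
    define \<nu> where "\<nu> = distr (density R (\<lambda>u. ennreal (w u))) (restrict_space borel {0<..}) lg"
    have w0: "0 \<le> w u" for u using \<phi>1 by (auto simp: w_def indicator_def)
    have [measurable]: "w \<in> borel_measurable borel" unfolding w_def[abs_def] by measurable
    have [measurable]: "lg \<in> borel_measurable borel" unfolding lg_def[abs_def] by measurable
    have lg_m: "lg \<in> measurable (density R (\<lambda>u. ennreal (w u))) (restrict_space borel {0<..})"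
    proof (rule measurable_restrict_space2)
      show "lg \<in> space (density R (\<lambda>u. ennreal (w u))) \<rightarrow> {0<..}" by (auto simp: lg_def)
    qed measurable
    have rm: "g \<in> borel_measurable (restrict_space borel {0<..})" if "g \<in> borel_measurable borel"
      for g :: "real \<Rightarrow> 'z :: topological_space"
      using that by (rule measurable_restrict_space1)
    have form: "impulse_response_form 0 K \<nu> \<phi>"
      unfolding impulse_response_form_def
    proof (intro conjI allI impI)
      show "0 \<le> K" using \<phi>1 by (simp add: K_def)
      show "sets \<nu> = sets (restrict_space borel {0<..})" by (simp add: \<nu>_def)
      have "(\<integral>\<^sup>+x. ennreal (x / (1 + x)) \<partial>\<nu>) = (\<integral>\<^sup>+u. ennreal (w u) * ennreal (lg u / (1 + lg u)) \<partial>R)"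
      proof -
        have "(\<integral>\<^sup>+x. ennreal (x / (1 + x)) \<partial>\<nu>) = (\<integral>\<^sup>+u. ennreal (lg u / (1 + lg u)) \<partial>density R (\<lambda>u. ennreal (w u)))"
          unfolding \<nu>_def by (rule nn_integral_distr[OF lg_m]) (auto intro!: rm)
        also have "\<dots> = (\<integral>\<^sup>+u. ennreal (w u) * ennreal (lg u / (1 + lg u)) \<partial>R)"
          by (rule nn_integral_density) auto
        finally show ?thesis .
      qed
      also have "\<dots> \<le> (\<integral>\<^sup>+u. ennreal (\<phi> 1) \<partial>R)"
      proof (rule nn_integral_mono)
        fix u
        show "ennreal (w u) * ennreal (lg u / (1 + lg u)) \<le> ennreal (\<phi> 1)"
        proof (cases "0 < u \<and> u < 1")
          case True
          then have l: "0 < lg u" "exp (- lg u) = u" by (auto simp: lg_def)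
          have "w u * (lg u / (1 + lg u)) \<le> w u * (1 - u)"
            using le_one_minus_exp[of "lg u"] l w0[of u] by (intro mult_left_mono) auto
          also have "\<dots> = \<phi> 1" using True by (simp add: w_def)
          finally show ?thesis using w0 by (simp add: ennreal_mult'[symmetric] ennreal_leI)
        qed (auto simp: w_def indicator_def)
      qed
      also have "\<dots> < \<infinity>" by (simp add: R.emeasure_space_1[simplified])
      finally show "(\<integral>\<^sup>+x. ennreal (x / (1 + x)) \<partial>\<nu>) < \<infinity>" .
      fix t :: real assume t: "0 \<le> t"
      show "\<phi> t = 0 + K * t + (LINT x|\<nu>. 1 - exp (- t * x))"
      proof (cases "t = 0")
        case True
        then show ?thesis using \<phi>0 by simp
      next
        case False
        with t have t: "0 < t" by simp
        have "(LINT x|\<nu>. 1 - exp (- t * x)) = (LINT u|density R (\<lambda>u. ennreal (w u)). 1 - exp (- t * lg u))"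
          unfolding \<nu>_def by (rule integral_distr[OF lg_m]) (auto intro!: rm)
        also have "\<dots> = (LINT u|R. w u * (1 - exp (- t * lg u)))"
          using w0 by (subst integral_density) auto
        also have "\<dots> = (LINT u|R. \<phi> 1 * (slope t u - indicator {..0} u - t * indicator {1..} u))"
        proof (rule Bochner_Integration.integral_cong[OF refl])
          fix u
          show "w u * (1 - exp (- t * lg u)) = \<phi> 1 * (slope t u - indicator {..0} u - t * indicator {1..} u)"
            by (auto simp: w_def lg_def slope_def indicator_def powr_def)
        qed
        also have "\<dots> = \<phi> 1 * ((LINT u|R. slope t u) - R.prob {..0} - t * R.prob {1..})"
          using slope_i[OF t] ind_i[of "{..0}"] ind_i[of "{1..}"] by simp
        also have "\<dots> = \<phi> t - K * t"
          by (simp add: no_mass rep[OF t] K_def algebra_simps)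
        finally show ?thesis by simp
      qed
    qed simp
    then show ?thesis by blast
  qed
qed

lemma additive_mono_imp_linear:
  fixes g :: "real \<Rightarrow> real"
  assumes add: "\<And>a b. 0 \<le> a \<Longrightarrow> 0 \<le> b \<Longrightarrow> g (a + b) = g a + g b"
    and mono: "\<And>a b. 0 \<le> a \<Longrightarrow> a \<le> b \<Longrightarrow> g a \<le> g b" and x: "0 \<le> x"
  shows "g x = x * g 1"
proof -
  have g0: "g 0 = 0" using add[of 0 0] by simp
  have mult: "g (real n * y) = real n * g y" if "0 \<le> y" for n y
    using that by (induction n) (simp_all add: g0 add distrib_right)
  have g1: "0 \<le> g 1" using mono[of 0 1] g0 by simp
  have bound: "real n * \<bar>g x - x * g 1\<bar> \<le> g 1" for n
  proof -
    define k where "k = nat \<lfloor>real n * x\<rfloor>"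
    have k: "real k \<le> real n * x" "real n * x \<le> real (Suc k)"
      using x by (auto simp: k_def) linarith
    have "real k * g 1 \<le> g (real n * x)" "g (real n * x) \<le> real (Suc k) * g 1"
      using mono[of "real k" "real n * x"] mono[of "real n * x" "real (Suc k)"] k x mult[of 1 k] mult[of 1 "Suc k"]
      by (auto simp del: of_nat_Suc)
    moreover have "real k * g 1 \<le> real n * x * g 1" "real n * x * g 1 \<le> real (Suc k) * g 1"
      using k g1 by (auto intro!: mult_right_mono simp del: of_nat_Suc)
    ultimately have "\<bar>g (real n * x) - real n * x * g 1\<bar> \<le> g 1"
      by (simp add: distrib_right abs_le_iff)
    moreover have "g (real n * x) - real n * x * g 1 = real n * (g x - x * g 1)"
      using mult[OF x, of n] by (simp add: algebra_simps)
    ultimately show ?thesis by (simp add: abs_mult)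
  qed
  show ?thesis
  proof (rule ccontr)
    assume "g x \<noteq> x * g 1"
    then obtain n where "g 1 < real n * \<bar>g x - x * g 1\<bar>"
      using reals_Archimedean3[of "\<bar>g x - x * g 1\<bar>"] by auto
    with bound[of n] show False by simp
  qed
qed

context subordinator
begin

definition Laplace_exponent :: "real \<Rightarrow> real" where
  "Laplace_exponent t = - ln (LINT \<omega>|M. exp (- t * (X 1 \<omega> - X 0 \<omega>)))"

lemma integrable_exp_increment:
  assumes "0 \<le> t" "0 \<le> \<sigma>" "\<sigma> \<le> \<tau>"
  shows "integrable M (\<lambda>\<omega>. exp (- t * (X \<tau> \<omega> - X \<sigma> \<omega>)))"
proof (rule integrable_const_bound[where B=1])
  show "AE \<omega> in M. norm (exp (- t * (X \<tau> \<omega> - X \<sigma> \<omega>))) \<le> 1"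
    using increment_nonneg[OF assms(2,3)] assms(1) by (intro AE_I2) (simp add: mult_nonneg_nonneg del: diff_ge_0_iff_ge)
  have [measurable]: "(\<lambda>\<omega>. X \<tau> \<omega> - X \<sigma> \<omega>) \<in> borel_measurable M" by (rule measurable_increment[OF assms(2,3)])
  show "(\<lambda>\<omega>. exp (- t * (X \<tau> \<omega> - X \<sigma> \<omega>))) \<in> borel_measurable M" by measurable
qed

text \<open>By stationarity the transform \<open>m s\<close> depends on the time span \<open>s\<close> only, and by independence
\<open>m (a + b) = m a * m b\<close>. Since \<open>m\<close> is positive and nonincreasing, \<open>- ln \<circ> m\<close> is additive and monotone,
hence linear.\<close>
lemma Laplace_increment:
  assumes t: "0 \<le> t" and \<sigma>\<tau>: "0 \<le> \<sigma>" "\<sigma> \<le> \<tau>"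
  shows "(LINT \<omega>|M. exp (- t * (X \<tau> \<omega> - X \<sigma> \<omega>))) = exp (- (\<tau> - \<sigma>) * Laplace_exponent t)"
proof -
  define m where "m s = (LINT \<omega>|M. exp (- t * (X s \<omega> - X 0 \<omega>)))" for s
  have shift: "(LINT \<omega>|M. exp (- t * (X b \<omega> - X a \<omega>))) = m (b - a)" if ab: "0 \<le> a" "a \<le> b" for a b
  proof -
    have E: "(LINT \<omega>|M. exp (- t * (X b \<omega> - X a \<omega>))) = (LINT x|distr M borel (\<lambda>\<omega>. X b \<omega> - X a \<omega>). exp (- t * x))"
      if "0 \<le> a" "a \<le> b" for a b
      using measurable_increment[OF that] by (simp add: integral_distr)
    show ?thesis
      using E[OF ab] E[of 0 "b - a"] stationary_increments[of a b 0 "b - a"] ab by (simp add: m_def)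
  qed
  have m_pos: "0 < m s" if "0 \<le> s" for s
  proof -
    have "m s \<noteq> 0"
    proof
      assume "m s = 0"
      then have "AE \<omega> in M. exp (- t * (X s \<omega> - X 0 \<omega>)) = 0"
        using integral_nonneg_eq_0_iff_AE[OF integrable_exp_increment[OF t order_refl that]] by (simp add: m_def)
      then show False by simp
    qed
    moreover have "0 \<le> m s" unfolding m_def by (intro integral_nonneg_AE AE_I2) simp
    ultimately show ?thesis by simp
  qed
  have m_mult: "m (a + b) = m a * m b" if ab: "0 \<le> a" "0 \<le> b" for a b
  proof (cases "a = 0 \<or> b = 0")
    case True
    then show ?thesis by (auto simp: m_def prob_space)
  next
    case False
    with ab have ab': "0 < a" "0 < b" by auto
    define \<tau> where "\<tau> i = (if i = 0 then 0 else if i = 1 then a else a + b)" for i :: nat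
    define Y where "Y i \<omega> = (if i = 0 then X 0 \<omega> else X (\<tau> i) \<omega> - X (\<tau> (i - 1)) \<omega>)" for i \<omega>
    have "indep_vars (\<lambda>_. borel) Y {0..2}"
      unfolding Y_def[abs_def]
      by (rule independent_increments) (use ab' in \<open>auto simp: \<tau>_def strict_mono_on_def\<close>)
    then have "indep_vars (\<lambda>_. borel) Y {1, 2}" by (rule indep_vars_subset) auto
    then have "indep_vars (\<lambda>_. borel) (\<lambda>i \<omega>. exp (- t * Y i \<omega>)) {1, 2}"
      by (rule indep_vars_compose2[where Y="\<lambda>_ x. exp (- t * x)"]) simp
    moreover have Y12: "Y 1 = (\<lambda>\<omega>. X a \<omega> - X 0 \<omega>)" "Y 2 = (\<lambda>\<omega>. X (a + b) \<omega> - X a \<omega>)"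
      by (auto simp: Y_def \<tau>_def)
    ultimately have "(LINT \<omega>|M. (\<Prod>i\<in>{1, 2}. exp (- t * Y i \<omega>))) = (\<Prod>i\<in>{1, 2}. LINT \<omega>|M. exp (- t * Y i \<omega>))"
      using integrable_exp_increment[OF t, of 0 a] integrable_exp_increment[OF t, of a "a + b"] ab
      by (intro indep_vars_lebesgue_integral) auto
    then have "(LINT \<omega>|M. exp (- t * (X a \<omega> - X 0 \<omega>)) * exp (- t * (X (a + b) \<omega> - X a \<omega>))) = m a * m b"
      using shift[of a "a + b"] ab by (simp add: Y12 Y12(1)[unfolded One_nat_def] m_def)
    moreover have "exp (- t * (X a \<omega> - X 0 \<omega>)) * exp (- t * (X (a + b) \<omega> - X a \<omega>)) = exp (- t * (X (a + b) \<omega> - X 0 \<omega>))" for \<omega>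
      by (simp add: exp_add[symmetric] algebra_simps)
    ultimately show ?thesis by (simp add: m_def)
  qed
  have m_mono: "m b \<le> m a" if ab: "0 \<le> a" "a \<le> b" for a b
    unfolding m_def
  proof (intro integral_mono integrable_exp_increment t order_refl)
    fix \<omega> assume "\<omega> \<in> space M"
    then have "X a \<omega> \<le> X b \<omega>" using increment_nonneg[OF ab] by simp
    then show "exp (- t * (X b \<omega> - X 0 \<omega>)) \<le> exp (- t * (X a \<omega> - X 0 \<omega>))"
      using t by (simp add: mult_left_mono)
  qed (use ab in auto)
  have "- ln (m (\<tau> - \<sigma>)) = (\<tau> - \<sigma>) * (- ln (m 1))"
  proof (rule additive_mono_imp_linear[of "\<lambda>s. - ln (m s)"])
    show "- ln (m (a + b)) = - ln (m a) + - ln (m b)" if "0 \<le> a" "0 \<le> b" for a b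
      using m_pos that by (simp add: m_mult ln_mult_pos)
    show "- ln (m a) \<le> - ln (m b)" if "0 \<le> a" "a \<le> b" for a b
      using m_mono[OF that] m_pos[of a] m_pos[of b] that by simp
  qed (use \<sigma>\<tau> in simp)
  then have "ln (m (\<tau> - \<sigma>)) = - (\<tau> - \<sigma>) * Laplace_exponent t"
    by (simp add: Laplace_exponent_def m_def algebra_simps)
  then have "m (\<tau> - \<sigma>) = exp (- (\<tau> - \<sigma>) * Laplace_exponent t)"
    using m_pos[of "\<tau> - \<sigma>"] \<sigma>\<tau> by (metis diff_ge_0_iff_ge exp_ln)
  then show ?thesis using shift[OF \<sigma>\<tau>] by simp
qed

lemma Laplace_exponent_form: "\<exists>K \<nu>. impulse_response_form 0 K \<nu> Laplace_exponent"
proof (rule infinitely_divisible_exponent)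
  fix n :: nat
  let ?D = "\<lambda>\<omega>. X (1 / real (Suc n)) \<omega> - X 0 \<omega>"
  have D [measurable]: "?D \<in> borel_measurable M" by (rule measurable_increment) auto
  show "real_distribution (distr M borel ?D)" using D by (rule real_distribution_distr)
  have "AE \<omega> in M. 0 \<le> ?D \<omega>" by (intro AE_I2 increment_nonneg) auto
  then show "AE x in distr M borel ?D. 0 \<le> x" by (subst AE_distr_iff[OF D]) simp_all
  show "(LINT x|distr M borel ?D. exp (- t * x)) = exp (- (Laplace_exponent t / real (Suc n)))" if "0 \<le> t" for t
  proof -
    have "(LINT x|distr M borel ?D. exp (- t * x)) = (LINT \<omega>|M. exp (- t * ?D \<omega>))"
      by (rule integral_distr[OF D]) simp
    also have "\<dots> = exp (- (1 / real (Suc n) - 0) * Laplace_exponent t)"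
      using that by (rule Laplace_increment) simp_all
    finally show ?thesis by simp
  qed
qed

end

section \<open>The correspondence between impulse responses and laws\<close>

lemma impulse_response_form_0: "impulse_response_form L K \<nu> f \<Longrightarrow> f 0 = L"
  by (auto simp: impulse_response_form_def)

lemma associated_processD:
  assumes "associated_process f M X"
  shows "subordinator M X" "0 \<le> f 0" "AE \<omega> in M. X 0 \<omega> = f 0"
    "\<And>t \<sigma> \<tau>. 0 \<le> t \<Longrightarrow> 0 \<le> \<sigma> \<Longrightarrow> \<sigma> \<le> \<tau> \<Longrightarrow>
      (LINT \<omega>|M. exp (- t * (X \<tau> \<omega> - X \<sigma> \<omega>))) = exp (- (\<tau> - \<sigma>) * (f t - f 0))"
  using assms impulse_response_form_0 unfolding associated_process_def
  by (auto simp: impulse_response_form_def)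

lemma associated_law_exists:
  assumes "f \<in> impulse_responses" shows "\<exists>P. associated_law f P"
proof -
  obtain L K \<nu> where "impulse_response_form L K \<nu> f"
    using assms by (auto simp: impulse_responses_def)
  then obtain M :: "(nat \<Rightarrow> nat \<times> (nat \<Rightarrow> real \<times> real)) measure" and X where "associated_process f M X"
    using exists_associated_process by blast
  then show ?thesis using associated_lawI by blast
qed

lemma associated_law_unique:
  assumes "associated_law f P" "associated_law f P'" shows "P = P'"
proof -
  obtain M :: "(real \<Rightarrow> real) measure" and X where M: "associated_process f M X" "P = process_law M X"
    using assms(1) by (auto simp: associated_law_def)
  obtain N :: "(real \<Rightarrow> real) measure" and Y where N: "associated_process f N Y" "P' = process_law N Y"
    using assms(2) by (auto simp: associated_law_def)
  note M' = associated_processD[OF M(1)] and N' = associated_processD[OF N(1)]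
  show ?thesis
    unfolding M(2) N(2)
    by (rule process_law_eqI_Laplace[OF M'(1) N'(1) M'(3) N'(3)]) (simp only: M'(4) N'(4))
qed

text \<open>The start and the unit increment are functions of the path, so their Laplace transforms can be
computed from the law alone.\<close>
lemma associated_law_determines:
  assumes "associated_law f P" "associated_law g P"
  shows "f 0 = g 0" "0 \<le> t \<Longrightarrow> f t = g t"
proof -
  have *: "(LINT p|P. exp (- p 0)) = exp (- f 0)"
    "0 \<le> t \<Longrightarrow> (LINT p|P. exp (- t * (p 1 - p 0))) = exp (- (f t - f 0))"
    if law: "associated_law f P" for f and t :: real
  proof -
    obtain M :: "(real \<Rightarrow> real) measure" and X where M: "associated_process f M X" and P: "P = process_law M X"
      using law by (auto simp: associated_law_def)
    note M' = associated_processD[OF M]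
    interpret subordinator M X by (rule M'(1))
    note G = process_map_measurable[of X M, OF measurable_X]
    have [measurable]: "(\<lambda>p. p s) \<in> borel_measurable (\<Pi>\<^sub>M \<tau>\<in>{0::real..}. (borel :: real measure))" if "0 \<le> s" for s
      by (rule measurable_component_singleton) (use that in simp)
    have m0: "(\<lambda>p. p 0) \<in> borel_measurable (\<Pi>\<^sub>M \<tau>\<in>{0::real..}. (borel :: real measure))"
      and m1: "(\<lambda>p. p 1) \<in> borel_measurable (\<Pi>\<^sub>M \<tau>\<in>{0::real..}. (borel :: real measure))" by simp_all
    note [measurable] = m0 m1
    have "(LINT p|P. exp (- p 0)) = (LINT \<omega>|M. exp (- X 0 \<omega>))"
      unfolding P process_law_def by (subst integral_distr[OF G]) simp_all
    also have "\<dots> = (LINT \<omega>|M. exp (- f 0))"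
      using M'(3) measurable_X[of 0] by (intro integral_cong_AE) auto
    finally show "(LINT p|P. exp (- p 0)) = exp (- f 0)" by (simp add: prob_space)
    assume t: "0 \<le> t"
    have "(LINT p|P. exp (- t * (p 1 - p 0))) = (LINT \<omega>|M. exp (- t * (X 1 \<omega> - X 0 \<omega>)))"
      unfolding P process_law_def by (subst integral_distr[OF G]) simp_all
    also have "\<dots> = exp (- (f t - f 0))" using M'(4)[OF t, of 0 1] by simp
    finally show "(LINT p|P. exp (- t * (p 1 - p 0))) = exp (- (f t - f 0))" .
  qed
  show 0: "f 0 = g 0" using *(1)[OF assms(1)] *(1)[OF assms(2)] by simp
  show "f t = g t" if "0 \<le> t" using *(2)[OF assms(1) that] *(2)[OF assms(2) that] 0 by simp
qed

lemma associated_law_in_deterministic_start_laws: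
  assumes "associated_law f P" shows "P \<in> deterministic_start_laws"
proof -
  obtain M :: "(real \<Rightarrow> real) measure" and X where M: "associated_process f M X" and P: "P = process_law M X"
    using assms by (auto simp: associated_law_def)
  show ?thesis unfolding P
    by (rule deterministic_start_lawsI[OF associated_processD(1,2,3)[OF M]])
qed

lemma deterministic_start_law_associated:
  assumes "P \<in> deterministic_start_laws"
  shows "\<exists>f\<in>impulse_responses. associated_law f P"
proof -
  obtain M :: "(real \<Rightarrow> real) measure" and X c where sub: "subordinator M X" and c: "0 \<le> c" "AE \<omega> in M. X 0 \<omega> = c"
      and P: "P = process_law M X"
    using assms by (auto simp: deterministic_start_laws_def)
  interpret subordinator M X by fact
  obtain K \<nu> where rep: "impulse_response_form 0 K \<nu> Laplace_exponent"
    using Laplace_exponent_form by blast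
  define f where "f = (\<lambda>t\<in>{0..}. c + Laplace_exponent t)"
  have form: "impulse_response_form c K \<nu> f"
    using rep c(1) by (simp add: impulse_response_form_def f_def)
  have "0 \<le> f t" if "0 \<le> t" for t
  proof -
    have \<nu>: "space \<nu> = {0<..}"
      using rep sets_eq_imp_space_eq[of \<nu> "restrict_space borel {0<..}"]
      by (simp add: impulse_response_form_def space_restrict_space)
    have "0 \<le> (LINT x|\<nu>. 1 - exp (- t * x))"
      using that by (intro integral_nonneg_AE AE_I2) (simp add: \<nu>)
    then show ?thesis using form that by (simp add: impulse_response_form_def)
  qed
  then have "f \<in> impulse_responses"
    unfolding impulse_responses_def using form by (auto simp: f_def)
  moreover have "associated_process f M X"
    unfolding associated_process_def
    using sub form c(2) Laplace_increment
    by (intro conjI exI[of _ c] exI[of _ K] exI[of _ \<nu>]) (auto simp: f_def)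
  ultimately show ?thesis unfolding P using associated_lawI by blast
qed

theorem mainTheorem1:
  shows "(\<forall>f\<in>impulse_responses. \<exists>!P. associated_law f P) \<and>
    bij_betw (\<lambda>f. THE P. associated_law f P) impulse_responses deterministic_start_laws"
proof
  show ex1: "\<forall>f\<in>impulse_responses. \<exists>!P. associated_law f P"
    using associated_law_exists associated_law_unique by blast
  have the_law: "(THE P. associated_law f P) = P" if "associated_law f P" for f P
    using that associated_law_unique by blast
  show "bij_betw (\<lambda>f. THE P. associated_law f P) impulse_responses deterministic_start_laws"
  proof (rule bij_betw_imageI)
    show "inj_on (\<lambda>f. THE P. associated_law f P) impulse_responses"
    proof (rule inj_onI)
      fix f g assume fg: "f \<in> impulse_responses" "g \<in> impulse_responses"
        and eq: "(THE P. associated_law f P) = (THE P. associated_law g P)"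
      obtain P P' where P: "associated_law f P" "associated_law g P'"
        using associated_law_exists fg by blast
      then have "associated_law g P" using eq the_law by metis
      then have "f t = g t" if "0 \<le> t" for t
        using associated_law_determines(2)[OF P(1)] that by blast
      moreover have "f \<in> extensional {0..}" "g \<in> extensional {0..}"
        using fg by (auto simp: impulse_responses_def PiE_def)
      ultimately show "f = g" by (intro extensionalityI) auto
    qed
    show "(\<lambda>f. THE P. associated_law f P) ` impulse_responses = deterministic_start_laws"
    proof (intro equalityI subsetI)
      fix P assume "P \<in> (\<lambda>f. THE P. associated_law f P) ` impulse_responses"
      then show "P \<in> deterministic_start_laws"
        using associated_law_exists the_law associated_law_in_deterministic_start_laws by force
    next
      fix P assume "P \<in> deterministic_start_laws"
      then show "P \<in> (\<lambda>f. THE P. associated_law f P) ` impulse_responses"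
        using deterministic_start_law_associated the_law by force
    qed
  qed
qed

end
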